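(* For any $n\ge3$ the center $Z(SG_n)$ of the singular braid group $SG_n$ is a direct factor in the singular pure braid group $SP_n$, but $Z(SG_n)$ is not a direct factor in $SG_n$.
   Context: The singular braid group $SG_n$ ($n\ge2$) is the group generated by $\sigma_1,\dots,\sigma_{n-1},\tau_1,\dots,\tau_{n-1}$ with defining relations: $\sigma_i\sigma_{i+1}\sigma_i=\sigma_{i+1}\sigma_i\sigma_{i+1}$ ($1\le i\le n-2$); $\sigma_i\sigma_j=\sigma_j\sigma_i$, $\tau_i\tau_j=\tau_j\tau_i$, $\tau_i\sigma_j=\sigma_j\tau_i$ for $|i-j|\ge2$; $\tau_i\sigma_i=\sigma_i\tau_i$ ($1\le i\le n-1$); $\sigma_i\sigma_{i+1}\tau_i=\tau_{i+1}\sigma_i\sigma_{i+1}$ and $\sigma_{i+1}\sigma_i\tau_{i+1}=\tau_i\sigma_{i+1}\sigma_i$ ($1\le i\le n-2$). The singular pure braid group $SP_n$ is the kernel of the homomorphism $\pi:SG_n\to S_n$ with $\pi(\sigma_i)=\pi(\tau_i)=(i,i+1)$ for all $i$. It is known that for $n\ge3$ one has $Z(SG_n)=Z(SP_n)$, and that this group is infinite cyclic, generated by $\Delta_n=(\sigma_1\sigma_2\cdots\sigma_{n-1})^n$; in particular $Z(SG_n)\subset SP_n$. A subgroup $Z$ of a group $G$ is a direct factor in $G$ if there is a subgroup $H\le G$ such that $G$ is the internal direct product $Z\times H$. *)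

theory Defs
  imports "HOL-Algebra.Sym_Groups"
begin

section \<open>Groups given by generators and relations\<close>

text \<open>A letter \<open>(x, True)\<close> stands for the generator \<open>x\<close>, and \<open>(x, False)\<close> for its formal inverse.\<close>

type_synonym 'a gword = "('a \<times> bool) list"

definition gwords :: "'a set \<Rightarrow> 'a gword set" where
  "gwords S = lists (S \<times> UNIV)"

definition pos_word :: "'a list \<Rightarrow> 'a gword" where
  "pos_word xs = map (\<lambda>x. (x, True)) xs"

inductive_set pres_cong :: "'a set \<Rightarrow> ('a gword \<times> 'a gword) set \<Rightarrow> ('a gword \<times> 'a gword) set"
  for S R where
  rel: "(u, v) \<in> R \<Longrightarrow> u \<in> gwords S \<Longrightarrow> v \<in> gwords S \<Longrightarrow> (u, v) \<in> pres_cong S R"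
| cancel: "x \<in> S \<Longrightarrow> ([(x, b), (x, \<not> b)], []) \<in> pres_cong S R"
| reflexive: "u \<in> gwords S \<Longrightarrow> (u, u) \<in> pres_cong S R"
| symmetric: "(u, v) \<in> pres_cong S R \<Longrightarrow> (v, u) \<in> pres_cong S R"
| transitive: "(u, v) \<in> pres_cong S R \<Longrightarrow> (v, w) \<in> pres_cong S R \<Longrightarrow> (u, w) \<in> pres_cong S R"
| compat: "(u, u') \<in> pres_cong S R \<Longrightarrow> (v, v') \<in> pres_cong S R
    \<Longrightarrow> (u @ v, u' @ v') \<in> pres_cong S R"

text \<open>The group with generating set \<open>S\<close> and defining relations \<open>u = v\<close> for \<open>(u, v) \<in> R\<close>:
  words modulo the least congruence containing \<open>R\<close> and the free cancellations.\<close>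

definition pres_class :: "'a set \<Rightarrow> ('a gword \<times> 'a gword) set \<Rightarrow> 'a gword \<Rightarrow> 'a gword set" where
  "pres_class S R w = pres_cong S R `` {w}"

definition pres_group :: "'a set \<Rightarrow> ('a gword \<times> 'a gword) set \<Rightarrow> 'a gword set monoid" where
  "pres_group S R =
    \<lparr>carrier = gwords S // pres_cong S R,
     mult = (\<lambda>X Y. \<Union>u\<in>X. \<Union>v\<in>Y. pres_class S R (u @ v)),
     one = pres_class S R []\<rparr>"

definition word_eval :: "('b, 'c) monoid_scheme \<Rightarrow> ('a \<Rightarrow> 'b) \<Rightarrow> 'a gword \<Rightarrow> 'b" where
  "word_eval H f w =
    foldr (\<lambda>(x, b) y. (if b then f x else inv\<^bsub>H\<^esub> f x) \<otimes>\<^bsub>H\<^esub> y) w \<one>\<^bsub>H\<^esub>"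

text \<open>The homomorphism from a presented group to \<open>H\<close> extending the assignment \<open>f\<close> of the
  generators. If \<open>f\<close> respects the relations, evaluation in \<open>H\<close> is constant on each class
  (lemma \<open>pres_lift_class\<close> below), so that \<open>the_elem\<close> picks out its value.\<close>

definition pres_lift :: "('b, 'c) monoid_scheme \<Rightarrow> ('a \<Rightarrow> 'b) \<Rightarrow> 'a gword set \<Rightarrow> 'b" where
  "pres_lift H f X = the_elem (word_eval H f ` X)"


subsection \<open>A presented group is a group\<close>

lemma gwords_simps [simp]:
  "[] \<in> gwords S" "x # u \<in> gwords S \<longleftrightarrow> fst x \<in> S \<and> u \<in> gwords S"
  "u @ v \<in> gwords S \<longleftrightarrow> u \<in> gwords S \<and> v \<in> gwords S"
  by (cases x; auto simp: gwords_def)+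

lemma pres_cong_gwords: "(u, v) \<in> pres_cong S R \<Longrightarrow> u \<in> gwords S \<and> v \<in> gwords S"
  by (induction rule: pres_cong.induct) auto

lemma equiv_pres_cong: "equiv (gwords S) (pres_cong S R)"
proof (rule equivI)
  show "pres_cong S R \<subseteq> gwords S \<times> gwords S"
    using pres_cong_gwords by fast
  show "refl_on (gwords S) (pres_cong S R)"
    by (rule refl_onI) (rule pres_cong.reflexive)
  show "sym (pres_cong S R)"
    by (rule symI) (rule pres_cong.symmetric)
  show "trans (pres_cong S R)"
    by (rule transI) (rule pres_cong.transitive)
qed

lemma pres_class_eq_iff:
  "u \<in> gwords S \<Longrightarrow> v \<in> gwords S \<Longrightarrow>
    pres_class S R u = pres_class S R v \<longleftrightarrow> (u, v) \<in> pres_cong S R"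
  unfolding pres_class_def by (rule eq_equiv_class_iff[OF equiv_pres_cong])

lemma pres_class_self: "u \<in> gwords S \<Longrightarrow> u \<in> pres_class S R u"
  unfolding pres_class_def by (simp add: pres_cong.reflexive)

lemma pres_group_carrier: "carrier (pres_group S R) = pres_class S R ` gwords S"
  by (auto simp: pres_group_def pres_class_def quotient_def)

lemma pres_group_one: "\<one>\<^bsub>pres_group S R\<^esub> = pres_class S R []"
  by (simp add: pres_group_def)

lemma pres_group_mult:
  assumes "u \<in> gwords S" "v \<in> gwords S"
  shows "pres_class S R u \<otimes>\<^bsub>pres_group S R\<^esub> pres_class S R v = pres_class S R (u @ v)"
proof -
  have "pres_class S R (u' @ v') = pres_class S R (u @ v)"
    if "u' \<in> pres_class S R u" "v' \<in> pres_class S R v" for u' v'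
  proof -
    from that have "(u @ v, u' @ v') \<in> pres_cong S R"
      unfolding pres_class_def by (simp add: pres_cong.compat)
    then show ?thesis
      unfolding pres_class_def by (metis equiv_class_eq equiv_pres_cong)
  qed
  then have "(\<Union>u'\<in>pres_class S R u. \<Union>v'\<in>pres_class S R v. pres_class S R (u' @ v'))
      = (\<Union>u'\<in>pres_class S R u. \<Union>v'\<in>pres_class S R v. pres_class S R (u @ v))"
    by (intro SUP_cong refl)
  also have "\<dots> = pres_class S R (u @ v)"
    using pres_class_self[OF assms(1)] pres_class_self[OF assms(2)] by blast
  finally show ?thesis
    by (simp add: pres_group_def)
qed

lemma pres_cong_inverse:
  "u \<in> gwords S \<Longrightarrow> (rev (map (\<lambda>(x, b). (x, \<not> b)) u) @ u, []) \<in> pres_cong S R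
     \<and> rev (map (\<lambda>(x, b). (x, \<not> b)) u) \<in> gwords S"
proof (induction u)
  case Nil
  show ?case by (simp add: pres_cong.reflexive)
next
  case (Cons a u)
  obtain x b where a: "a = (x, b)" by fastforce
  let ?v = "rev (map (\<lambda>(x, b). (x, \<not> b)) u)"
  have x: "x \<in> S" and u: "u \<in> gwords S" using Cons.prems a by auto
  with Cons.IH have IH: "(?v @ u, []) \<in> pres_cong S R" "?v \<in> gwords S" by auto
  have "([(x, \<not> b), (x, b)] @ u, [] @ u) \<in> pres_cong S R"
    using pres_cong.cancel[of x S "\<not> b" R] x u by (intro pres_cong.compat pres_cong.reflexive) auto
  then have "(?v @ [(x, \<not> b), (x, b)] @ u, ?v @ [] @ u) \<in> pres_cong S R"
    by (rule pres_cong.compat[OF pres_cong.reflexive[OF IH(2)]])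
  then show ?case
    using pres_cong.transitive IH x by (fastforce simp: a)
qed

lemma group_pres_group: "group (pres_group S R)"
proof (rule groupI)
  fix X assume "X \<in> carrier (pres_group S R)"
  then obtain u where u: "u \<in> gwords S" "X = pres_class S R u"
    by (auto simp: pres_group_carrier)
  define v where "v = rev (map (\<lambda>(x, b). (x, \<not> b)) u)"
  have "(v @ u, []) \<in> pres_cong S R" "v \<in> gwords S"
    using pres_cong_inverse[OF u(1)] by (auto simp: v_def)
  then show "\<exists>Y\<in>carrier (pres_group S R). Y \<otimes>\<^bsub>pres_group S R\<^esub> X = \<one>\<^bsub>pres_group S R\<^esub>"
    using u by (intro bexI[of _ "pres_class S R v"])
      (auto simp: pres_group_mult pres_group_one pres_class_eq_iff pres_group_carrier)
qed (auto simp: pres_group_carrier pres_group_mult pres_group_one)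


subsection \<open>Homomorphisms out of a presented group\<close>

lemma word_eval_closed:
  assumes "group H" "f \<in> S \<rightarrow> carrier H" "u \<in> gwords S"
  shows "word_eval H f u \<in> carrier H"
proof -
  interpret H: group H by fact
  show ?thesis using assms(2,3) by (induction u) (auto simp: word_eval_def Pi_iff)
qed

lemma word_eval_append:
  assumes "group H" "f \<in> S \<rightarrow> carrier H" "u \<in> gwords S" "v \<in> gwords S"
  shows "word_eval H f (u @ v) = word_eval H f u \<otimes>\<^bsub>H\<^esub> word_eval H f v"
proof -
  interpret H: group H by fact
  note cl = word_eval_closed[OF assms(1,2)]
  show ?thesis
    using assms(3)
  proof (induction u)
    case Nil
    then show ?case using cl[OF assms(4)] by (simp add: word_eval_def)
  next
    case (Cons a u)
    obtain x b where a: "a = (x, b)" by fastforce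
    have *: "word_eval H f (a # w) = (if b then f x else inv\<^bsub>H\<^esub> f x) \<otimes>\<^bsub>H\<^esub> word_eval H f w" for w
      by (simp add: word_eval_def a)
    have "f x \<in> carrier H" using Cons.prems a assms(2) by auto
    then show ?case
      using Cons cl[of u] cl[OF assms(4)] by (auto simp: * H.m_assoc)
  qed
qed

locale pres_hom = group H for H (structure) +
  fixes S R f
  assumes gens_closed: "f \<in> S \<rightarrow> carrier H"
    and rels_hold: "\<And>u v. (u, v) \<in> R \<Longrightarrow> word_eval H f u = word_eval H f v"
begin

lemma word_eval_cong: "(u, v) \<in> pres_cong S R \<Longrightarrow> word_eval H f u = word_eval H f v"
proof (induction rule: pres_cong.induct)
  case (rel u v)
  then show ?case by (blast intro: rels_hold)
next
  case (cancel x b)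
  then have "f x \<in> carrier H" using gens_closed by auto
  then show ?case by (auto simp: word_eval_def)
next
  case (compat u u' v v')
  then show ?case
    using word_eval_append[OF is_group gens_closed] pres_cong_gwords by metis
qed simp_all

lemma pres_lift_class:
  assumes "u \<in> gwords S" shows "pres_lift H f (pres_class S R u) = word_eval H f u"
proof -
  have "word_eval H f v = word_eval H f u" if "v \<in> pres_class S R u" for v
    using word_eval_cong[of u v] that by (simp add: pres_class_def)
  moreover have "u \<in> pres_class S R u" by (rule pres_class_self[OF assms])
  ultimately have "word_eval H f ` pres_class S R u = {word_eval H f u}" by blast
  then show ?thesis by (simp add: pres_lift_def)
qed

lemma pres_lift_hom: "pres_lift H f \<in> hom (pres_group S R) H"
  by (rule homI) (auto simp: pres_group_carrier pres_group_mult pres_lift_class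
      word_eval_append[OF is_group gens_closed] word_eval_closed[OF is_group gens_closed])

lemma pres_lift_gen:
  assumes "x \<in> S" shows "pres_lift H f (pres_class S R [(x, True)]) = f x"
proof -
  have "f x \<in> carrier H" using assms gens_closed by auto
  then show ?thesis using assms by (simp add: pres_lift_class word_eval_def)
qed

end


section \<open>The singular braid group and the singular pure braid group\<close>

datatype sgen = Sig nat | Tau nat

definition sing_braid_gens :: "nat \<Rightarrow> sgen set" where
  "sing_braid_gens n = Sig ` {1..n-1} \<union> Tau ` {1..n-1}"

definition sing_braid_rels :: "nat \<Rightarrow> (sgen gword \<times> sgen gword) set" where
  "sing_braid_rels n = map_prod pos_word pos_word `
    ( {([Sig i, Sig (i+1), Sig i], [Sig (i+1), Sig i, Sig (i+1)]) | i. i \<in> {1..n-2}}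
    \<union> {([Sig i, Sig j], [Sig j, Sig i]) | i j.
         i \<in> {1..n-1} \<and> j \<in> {1..n-1} \<and> \<bar>int i - int j\<bar> \<ge> 2}
    \<union> {([Tau i, Tau j], [Tau j, Tau i]) | i j.
         i \<in> {1..n-1} \<and> j \<in> {1..n-1} \<and> \<bar>int i - int j\<bar> \<ge> 2}
    \<union> {([Tau i, Sig j], [Sig j, Tau i]) | i j.
         i \<in> {1..n-1} \<and> j \<in> {1..n-1} \<and> \<bar>int i - int j\<bar> \<ge> 2}
    \<union> {([Tau i, Sig i], [Sig i, Tau i]) | i. i \<in> {1..n-1}}
    \<union> {([Sig i, Sig (i+1), Tau i], [Tau (i+1), Sig i, Sig (i+1)]) | i. i \<in> {1..n-2}}
    \<union> {([Sig (i+1), Sig i, Tau (i+1)], [Tau i, Sig (i+1), Sig i]) | i. i \<in> {1..n-2}})"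

definition sing_braid_group :: "nat \<Rightarrow> sgen gword set monoid" where
  "sing_braid_group n = pres_group (sing_braid_gens n) (sing_braid_rels n)"

fun sgen_perm :: "sgen \<Rightarrow> nat \<Rightarrow> nat" where
  "sgen_perm (Sig i) = transpose i (i+1)"
| "sgen_perm (Tau i) = transpose i (i+1)"

definition sing_braid_perm :: "nat \<Rightarrow> sgen gword set \<Rightarrow> nat \<Rightarrow> nat" where
  "sing_braid_perm n = pres_lift (sym_group n) sgen_perm"

definition sing_pure_braid_group :: "nat \<Rightarrow> sgen gword set monoid" where
  "sing_pure_braid_group n = (sing_braid_group n)
    \<lparr>carrier := kernel (sing_braid_group n) (sym_group n) (sing_braid_perm n)\<rparr>"

lemma pres_hom_sing_braid:
  "pres_hom (sym_group n) (sing_braid_gens n) (sing_braid_rels n) sgen_perm"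
proof -
  interpret group "sym_group n" by (rule sym_group_is_group)
  show ?thesis
  proof
    show "sgen_perm \<in> sing_braid_gens n \<rightarrow> carrier (sym_group n)"
      by (auto simp: sing_braid_gens_def sym_group_carrier intro!: permutes_swap_id)
    show "word_eval (sym_group n) sgen_perm u = word_eval (sym_group n) sgen_perm v"
      if "(u, v) \<in> sing_braid_rels n" for u v
    proof -
      have far: "transpose i (Suc i) \<circ> transpose j (Suc j) = transpose j (Suc j) \<circ> transpose i (Suc i)"
        if "\<bar>int i - int j\<bar> \<ge> 2" for i j
        using that by (auto simp: fun_eq_iff transpose_def)
      have braid: "transpose i (Suc i) \<circ> (transpose (Suc i) (Suc (Suc i)) \<circ> transpose i (Suc i))
          = transpose (Suc i) (Suc (Suc i)) \<circ> (transpose i (Suc i) \<circ> transpose (Suc i) (Suc (Suc i)))"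
        for i
        by (simp add: fun_eq_iff transpose_def)
      show ?thesis
        using that unfolding sing_braid_rels_def
        by (elim imageE UnE)
          (auto simp: pos_word_def word_eval_def sym_group_mult sym_group_one far braid)
    qed
  qed
qed

lemma group_sing_braid_group: "group (sing_braid_group n)"
  unfolding sing_braid_group_def by (rule group_pres_group)

lemma sing_braid_perm_hom: "sing_braid_perm n \<in> hom (sing_braid_group n) (sym_group n)"
  unfolding sing_braid_perm_def sing_braid_group_def
  by (rule pres_hom.pres_lift_hom[OF pres_hom_sing_braid])

lemma sing_braid_perm_gen:
  "x \<in> sing_braid_gens n \<Longrightarrow>
    sing_braid_perm n (pres_class (sing_braid_gens n) (sing_braid_rels n) [(x, True)]) = sgen_perm x"
  unfolding sing_braid_perm_def by (rule pres_hom.pres_lift_gen[OF pres_hom_sing_braid])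

lemma group_sing_pure_braid_group: "group (sing_pure_braid_group n)"
proof -
  interpret group_hom "sing_braid_group n" "sym_group n" "sing_braid_perm n"
    using group_sing_braid_group sym_group_is_group sing_braid_perm_hom
    by (simp add: group_hom_def group_hom_axioms_def)
  show ?thesis
    unfolding sing_pure_braid_group_def
    by (rule subgroup.subgroup_is_group[OF subgroup_kernel group_sing_braid_group])
qed


section \<open>Center and direct factors\<close>

definition group_center :: "('a, 'b) monoid_scheme \<Rightarrow> 'a set" where
  "group_center G = {z \<in> carrier G. \<forall>g\<in>carrier G. z \<otimes>\<^bsub>G\<^esub> g = g \<otimes>\<^bsub>G\<^esub> z}"

definition internal_direct_product :: "('a, 'b) monoid_scheme \<Rightarrow> 'a set \<Rightarrow> 'a set \<Rightarrow> bool" where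
  "internal_direct_product G A B \<longleftrightarrow>
    A \<lhd> G \<and> B \<lhd> G \<and> A \<inter> B = {\<one>\<^bsub>G\<^esub>} \<and> A <#>\<^bsub>G\<^esub> B = carrier G"

definition direct_factor :: "'a set \<Rightarrow> ('a, 'b) monoid_scheme \<Rightarrow> bool" where
  "direct_factor Z G \<longleftrightarrow> subgroup Z G \<and> (\<exists>H. subgroup H G \<and> internal_direct_product G Z H)"

end

(*
  The center Z of SG_n is generated by the full twist D = Delta^2. Put t_i = tau_i sigma_i^-1.
  The group SG_n acts on the right-angled Artin group A whose vertices are the conjugates of the
  t_i under the braid group, two vertices being joined if they commute in SG_n: sigma_i permutes
  the vertices and t_i multiplies by the vertex t_i. A central element z maps the neutral element
  of A to an element a that is fixed by the braid group; its smallest supporting set of vertices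
  is then invariant and finite, hence empty, since the orbits of vertices are infinite by the
  Burau representation at -1. So a = 1, which means that z equals its image under
  tau_i |-> sigma_i. After multiplication by a power of D this image is a positive braid that
  commutes with all sigma_i, and by Garside's analysis of common multiples in the positive braid
  monoid it is divisible by Delta as long as it is not trivial; hence z is a power of D.

  The linking number of the first two strands, with tau_i counted as sigma_i, is a homomorphism
  from SP_n to the integers with value 1 on D, so its kernel is a complement of Z in SP_n. A
  complement of Z in SG_n would give a homomorphism from SG_n to the integers with value 1 on D;
  the sigma_i are all conjugate and D is a word of even length in them, so the value is even.
*)
theory Submission
  imports Defs "HOL-Algebra.Elementary_Groups"
begin

section \<open>The half twist\<close>

text \<open>The vertices of A are taken as elements of SG_n, not as formal symbols. Words in them
  can therefore be evaluated in SG_n, and every element turns out to be the value of its orbit point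
  (the image of the neutral element of A) times its image under tau_i |-> sigma_i. This is why a = 1
  identifies z with a braid. Centrality is a statement in a group, whereas Garside's theory speaks
  of positive words. The bridge is that every sigma_i divides Delta, so that D sigma_i^-1 is
  positive: a braid word with l letters is a fraction with denominator D^l, and cancellation in the
  positive monoid allows such fractions to be compared after cross-multiplication. At the parameter
  -1 of the Burau representation sigma_i acts by an integral transvection, whose powers grow
  linearly. If tau_i acts trivially, then t_i acts as sigma_i^-1, and its conjugates by the powers
  of a neighbouring sigma_j can be told apart by a single coordinate. Such a neighbour exists
  because n >= 3.\<close>

fun desc_word :: "nat \<Rightarrow> nat list" where
  "desc_word 0 = []"
| "desc_word (Suc k) = Suc k # desc_word k"

text \<open>Garside's Delta on \<open>k + 1\<close> strands, written as 1, 21, 321 and so on. In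
  this form it begins with the Delta on fewer strands, on which the inductions rest.\<close>

fun half_twist_word :: "nat \<Rightarrow> nat list" where
  "half_twist_word 0 = []"
| "half_twist_word (Suc k) = half_twist_word k @ desc_word (Suc k)"

lemma set_desc_word: "set (desc_word k) = {1..k}"
  by (induction k) auto

lemma set_half_twist_word: "set (half_twist_word k) = {1..k}"
  by (induction k) (auto simp: set_desc_word)

text \<open>The relations involving \<open>x\<close> hold both for \<open>\<sigma>\<close> and for \<open>\<tau>\<close> in place of \<open>x\<close>, so that
  conjugation by the half twist can be computed for both kinds of generators at once.\<close>

locale braid_pair =
  fixes s x :: "nat \<Rightarrow> 'a::monoid_mult"
  assumes braid: "s i * (s (Suc i) * s i) = s (Suc i) * (s i * s (Suc i))"
    and far: "Suc i < j \<Longrightarrow> s i * s j = s j * s i"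
    and x_far: "Suc i < j \<or> Suc j < i \<Longrightarrow> x i * s j = s j * x i"
    and x_same: "x i * s i = s i * x i"
    and x_up: "s i * (s (Suc i) * x i) = x (Suc i) * (s i * s (Suc i))"
    and x_down: "s (Suc i) * (s i * x (Suc i)) = x i * (s (Suc i) * s i)"
begin

definition ev :: "nat list \<Rightarrow> 'a" where "ev w = prod_list (map s w)"

lemma ev_simps [simp]: "ev [] = 1" "ev (i # w) = s i * ev w" "ev (u @ v) = ev u * ev v"
  by (simp_all add: ev_def)

lemma x_far_ev: "(\<And>j. j \<in> set w \<Longrightarrow> Suc i < j \<or> Suc j < i) \<Longrightarrow> x i * ev w = ev w * x i"
proof (induction w)
  case (Cons j w)
  then have j: "x i * s j = s j * x i" and w: "x i * ev w = ev w * x i"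
    using x_far by simp_all
  have "x i * (s j * ev w) = s j * (x i * ev w)"
    by (simp only: mult.assoc[symmetric] j)
  then show ?case by (simp add: w mult.assoc)
qed simp

text \<open>The two letters i + 1, i turn x_i into x_(i+1) by \<open>x_down\<close>; the letters
  before them are far from i, those after them are far from i + 1.\<close>

lemma x_desc: "1 \<le> i \<Longrightarrow> i < k \<Longrightarrow> x i * ev (desc_word k) = ev (desc_word k) * x (Suc i)"
proof (induction k)
  case (Suc k)
  show ?case
  proof (cases "i = k")
    case True
    with Suc obtain j where j: "k = Suc j" by (cases k) auto
    have "x i * ev (desc_word (Suc k)) = x k * (s (Suc k) * s k) * ev (desc_word j)"
      by (simp add: True j mult.assoc)
    also have "\<dots> = s (Suc k) * s k * (x (Suc k) * ev (desc_word j))"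
      by (simp add: x_down[symmetric] mult.assoc)
    also have "x (Suc k) * ev (desc_word j) = ev (desc_word j) * x (Suc k)"
      by (rule x_far_ev) (auto simp: set_desc_word j)
    finally show ?thesis by (simp add: True j mult.assoc)
  next
    case False
    with Suc have "i < k" by simp
    then have "x i * s (Suc k) = s (Suc k) * x i" using x_far by simp
    then have "x i * ev (desc_word (Suc k)) = s (Suc k) * (x i * ev (desc_word k))"
      by (simp add: mult.assoc[symmetric])
    with Suc \<open>i < k\<close> show ?thesis by (simp add: mult.assoc)
  qed
qed simp

text \<open>Each pair s_j s_(j+1) raises the index of x from j to j + 1 by \<open>x_up\<close>. The
  product arises from two consecutive descending words (\<open>desc_desc\<close>) and serves the top
  index in \<open>x_half_twist\<close>.\<close>

fun asc_pairs :: "nat \<Rightarrow> 'a" where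
  "asc_pairs 0 = 1"
| "asc_pairs (Suc k) = s (Suc k) * s (Suc (Suc k)) * asc_pairs k"

lemma x_asc_pairs: "asc_pairs k * x 1 = x (Suc k) * asc_pairs k"
proof (induction k)
  case (Suc k)
  have "asc_pairs (Suc k) * x 1 = (s (Suc k) * (s (Suc (Suc k)) * x (Suc k))) * asc_pairs k"
    using Suc by (simp add: mult.assoc)
  then show ?case by (simp only: x_up asc_pairs.simps mult.assoc)
qed simp

sublocale S: braid_pair s s
proof
  show "s i * s j = s j * s i" if "Suc i < j \<or> Suc j < i" for i j
    using that far[of i j] far[of j i] by auto
qed (use braid far in auto)

lemmas s_far_ev = S.x_far_ev

lemma desc_desc: "ev (desc_word k) * ev (desc_word (Suc k)) = s (Suc k) * asc_pairs k"
proof (induction k)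
  case (Suc k)
  have "ev (desc_word (Suc k)) * ev (desc_word (Suc (Suc k)))
      = s (Suc k) * (ev (desc_word k) * s (Suc (Suc k))) * ev (desc_word (Suc k))"
    by (simp add: mult.assoc)
  also have "ev (desc_word k) * s (Suc (Suc k)) = s (Suc (Suc k)) * ev (desc_word k)"
    by (rule s_far_ev[symmetric]) (auto simp: set_desc_word)
  also have "s (Suc k) * (s (Suc (Suc k)) * ev (desc_word k)) * ev (desc_word (Suc k))
     = s (Suc k) * s (Suc (Suc k)) * (ev (desc_word k) * ev (desc_word (Suc k)))"
    by (simp add: mult.assoc)
  also have "\<dots> = s (Suc k) * (s (Suc (Suc k)) * s (Suc k)) * asc_pairs k"
    unfolding Suc by (simp add: mult.assoc)
  finally show ?case unfolding braid by (simp add: mult.assoc)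
qed simp

lemma x_half_twist:
  "1 \<le> i \<Longrightarrow> i \<le> k \<Longrightarrow> x i * ev (half_twist_word k) = ev (half_twist_word k) * x (Suc k - i)"
proof (induction k)
  case (Suc k)
  show ?case
  proof (cases "i = Suc k")
    case False
    with Suc have i: "1 \<le> i" "i \<le> k" by auto
    have "x i * ev (half_twist_word (Suc k)) = (x i * ev (half_twist_word k)) * ev (desc_word (Suc k))"
      by (simp add: mult.assoc)
    also have "\<dots> = ev (half_twist_word k) * (x (Suc k - i) * ev (desc_word (Suc k)))"
      using Suc i by (simp add: mult.assoc)
    also have "x (Suc k - i) * ev (desc_word (Suc k)) = ev (desc_word (Suc k)) * x (Suc (Suc k - i))"
      using i by (intro x_desc) auto
    also have "Suc (Suc k - i) = Suc (Suc k) - i" using i by simp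
    finally show ?thesis by (simp only: half_twist_word.simps ev_simps mult.assoc)
  next
    case True
    show ?thesis
    proof (cases k)
      case 0
      then show ?thesis using True x_same[of 1] by simp
    next
      case (Suc j)
      \<comment> \<open>The top index lies outside the induction hypothesis. Its neighbour k occurs
        in the last two descending words only, so these are rewritten together; all earlier letters
        are far from the top index.\<close>
      have D: "ev (half_twist_word (Suc k))
          = ev (half_twist_word j) * (s (Suc k) * asc_pairs k)"
        unfolding Suc using desc_desc[of "Suc j"] by (simp only: half_twist_word.simps ev_simps mult.assoc)
      have h: "x (Suc k) * ev (half_twist_word j) = ev (half_twist_word j) * x (Suc k)"
        by (rule x_far_ev) (auto simp: set_half_twist_word Suc)
      have "x (Suc k) * ev (half_twist_word (Suc k))
          = ev (half_twist_word j) * (x (Suc k) * s (Suc k)) * asc_pairs k"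
        by (simp only: D mult.assoc[symmetric] h)
      also have "\<dots> = ev (half_twist_word j) * s (Suc k) * (x (Suc k) * asc_pairs k)"
        by (simp only: x_same mult.assoc)
      also have "\<dots> = ev (half_twist_word (Suc k)) * x 1"
        unfolding D by (simp only: mult.assoc x_asc_pairs)
      finally show ?thesis using True by simp
    qed
  qed
qed simp

lemma x_full_twist:
  assumes "1 \<le> i" "i \<le> k"
  shows "x i * (ev (half_twist_word k) * ev (half_twist_word k))
       = (ev (half_twist_word k) * ev (half_twist_word k)) * x i"
proof -
  have "x i * (ev (half_twist_word k) * ev (half_twist_word k))
      = ev (half_twist_word k) * (x (Suc k - i) * ev (half_twist_word k))"
    by (simp only: mult.assoc[symmetric] x_half_twist[OF assms])
  also have "x (Suc k - i) * ev (half_twist_word k) = ev (half_twist_word k) * x (Suc k - (Suc k - i))"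
    using assms by (intro x_half_twist) auto
  finally show ?thesis using assms by (simp add: mult.assoc)
qed

end

section \<open>Monoids given by generators and relations\<close>

inductive word_step :: "('l list \<times> 'l list) set \<Rightarrow> 'l list \<Rightarrow> 'l list \<Rightarrow> bool" for R where
  "(l, r) \<in> R \<Longrightarrow> word_step R (a @ l @ b) (a @ r @ b)"

abbreviation word_eq :: "('l list \<times> 'l list) set \<Rightarrow> 'l list \<Rightarrow> 'l list \<Rightarrow> bool" where
  "word_eq R \<equiv> equivclp (word_step R)"

lemma word_eq_rel: "(l, r) \<in> R \<Longrightarrow> word_eq R l r"
  using word_step.intros[of l r R "[]" "[]"] by (auto intro: r_into_equivclp)

lemma word_step_append: "word_step R u v \<Longrightarrow> word_step R (a @ u @ b) (a @ v @ b)"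
proof (induction rule: word_step.induct)
  case (1 l r c d)
  then show ?case using word_step.intros[of l r R "a @ c" "d @ b"] by simp
qed

lemma word_eq_append1: "word_eq R u v \<Longrightarrow> word_eq R (a @ u @ b) (a @ v @ b)"
proof (induction rule: equivclp_induct)
  case (step y z)
  then have "word_eq R (a @ y @ b) (a @ z @ b)"
    using word_step_append[of R y z a b] word_step_append[of R z y a b]
    by (auto intro: r_into_equivclp converse_r_into_equivclp)
  with step show ?case using equivclp_trans by metis
qed simp

lemma word_eq_append: "word_eq R u u' \<Longrightarrow> word_eq R v v' \<Longrightarrow> word_eq R (u @ v) (u' @ v')"
  using word_eq_append1[of R u u' "[]" v] word_eq_append1[of R v v' u' "[]"] equivclp_trans
  by fastforce

lemma equivp_word_eq: "equivp (word_eq R)"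
  by (rule equivpI) (auto simp: reflp_def symp_def transp_def intro: equivclp_sym equivclp_trans)

lemma word_eq_invariant:
  assumes "word_eq R u v" "\<And>l r a b. (l, r) \<in> R \<Longrightarrow> f (a @ l @ b) = f (a @ r @ b)"
  shows "f u = f v"
  using assms(1) by (induction rule: equivclp_induct) (auto elim!: word_step.cases simp: assms(2))


section \<open>The positive braid monoid\<close>

text \<open>Braids on infinitely many strands: a single type, an instance of
  \<open>monoid_mult\<close>, then serves all n. The relations preserve the set of letters, so the
  strands involved can be read off with \<open>letters\<close>.\<close>

definition braid_rels :: "(nat list \<times> nat list) set" where
  "braid_rels = {([i, Suc i, i], [Suc i, i, Suc i]) | i. True} \<union> {([i, j], [j, i]) | i j. Suc i < j}"

abbreviation "braid_step \<equiv> word_step braid_rels"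
abbreviation "braid_eq \<equiv> word_eq braid_rels"

lemma braid_step_cases [consumes 1, case_names braid far]:
  assumes "braid_step u v"
  obtains a i b where "u = a @ [i, Suc i, i] @ b" "v = a @ [Suc i, i, Suc i] @ b"
  | a i j b where "Suc i < j" "u = a @ [i, j] @ b" "v = a @ [j, i] @ b"
  using assms by (auto elim!: word_step.cases simp: braid_rels_def)

lemma braid_eq_length: "braid_eq u v \<Longrightarrow> length u = length v"
  by (erule word_eq_invariant) (auto simp: braid_rels_def)

lemma braid_eq_set: "braid_eq u v \<Longrightarrow> set u = set v"
  by (erule word_eq_invariant) (auto simp: braid_rels_def)

quotient_type braid_monoid = "nat list" / braid_eq
  by (rule equivp_word_eq)

instantiation braid_monoid :: monoid_mult
begin

lift_definition one_braid_monoid :: braid_monoid is "[]" .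
lift_definition times_braid_monoid :: "braid_monoid \<Rightarrow> braid_monoid \<Rightarrow> braid_monoid" is "(@)"
  by (rule word_eq_append)

instance by standard (transfer; simp)+

end

lift_definition gen :: "nat \<Rightarrow> braid_monoid" is "\<lambda>i. [i]" .

lift_definition len :: "braid_monoid \<Rightarrow> nat" is length
  by (rule braid_eq_length)

lift_definition letters :: "braid_monoid \<Rightarrow> nat set" is set
  by (rule braid_eq_set)

lemma len_simps [simp]: "len 1 = 0" "len (gen i) = 1" "len (x * y) = len x + len y"
  by (transfer; simp)+

lemma letters_simps [simp]: "letters 1 = {}" "letters (gen i) = {i}" "letters (x * y) = letters x \<union> letters y"
  by (transfer; simp)+

lemma gen_braid: "gen i * (gen (Suc i) * gen i) = gen (Suc i) * (gen i * gen (Suc i))"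
  by transfer (auto simp: braid_rels_def intro!: word_eq_rel)

lemma gen_far: "Suc i < j \<Longrightarrow> gen i * gen j = gen j * gen i"
  by transfer (auto simp: braid_rels_def intro!: word_eq_rel)

interpretation B: braid_pair gen gen
proof
  show "gen i * gen j = gen j * gen i" if "Suc i < j \<or> Suc j < i" for i j
    using that gen_far[of i j] gen_far[of j i] by auto
qed (use gen_braid gen_far in auto)

lemma abs_braid_monoid: "abs_braid_monoid w = B.ev w"
proof (induction w)
  case Nil
  then show ?case by (simp only: one_braid_monoid.abs_eq[symmetric] B.ev_simps)
next
  case (Cons a w)
  have "abs_braid_monoid (a # w) = abs_braid_monoid [a] * abs_braid_monoid w"
    by (simp only: times_braid_monoid.abs_eq append.simps)
  then show ?case by (simp only: gen.abs_eq[symmetric] Cons B.ev_simps)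
qed

lemma ev_eq_iff: "B.ev u = B.ev v \<longleftrightarrow> braid_eq u v"
  by (metis abs_braid_monoid braid_monoid.abs_eq_iff)

lemma len_ev [simp]: "len (B.ev w) = length w"
  by (induction w) auto

lemma letters_ev [simp]: "letters (B.ev w) = set w"
  by (induction w) auto

lemma ev_surj: "\<exists>w. y = B.ev w"
  by (metis abs_braid_monoid Quotient_abs_rep Quotient_braid_monoid)


section \<open>Least common multiples of letters in the positive braid monoid\<close>

definition adj :: "nat \<Rightarrow> nat \<Rightarrow> bool" where
  "adj a b \<longleftrightarrow> a = Suc b \<or> b = Suc a"

text \<open>The complement of \<open>gen a\<close> in the least common right multiple of the two
  letters: \<open>gen a * res a b = gen b * res b a\<close>.\<close>

definition res :: "nat \<Rightarrow> nat \<Rightarrow> braid_monoid" where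
  "res a b = (if a = b then 1 else if adj a b then gen b * gen a else gen b)"

lemma adj_sym: "adj a b \<longleftrightarrow> adj b a"
  by (auto simp: adj_def)

lemma gen_adj: "adj a b \<Longrightarrow> gen a * (gen b * (gen a * X)) = gen b * (gen a * (gen b * X))"
  using gen_braid[of a] gen_braid[of b] by (auto simp: adj_def simp flip: mult.assoc)

lemma gen_nadj: "\<not> adj a b \<Longrightarrow> gen a * (gen b * X) = gen b * (gen a * X)"
proof -
  assume "\<not> adj a b"
  then have "a = b \<or> Suc a < b \<or> Suc b < a" by (auto simp: adj_def)
  then have "gen a * gen b = gen b * gen a" using gen_far[of a b] gen_far[of b a] by auto
  then show ?thesis by (simp flip: mult.assoc)
qed

text \<open>Left cancellation (the case \<open>a = b\<close>) together with the minimality of the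
  common multiples given by \<open>res\<close>. The bound on the length makes it usable as an
  induction hypothesis.\<close>

definition lcm_below :: "nat \<Rightarrow> bool" where
  "lcm_below L \<longleftrightarrow> (\<forall>a b X Y. len X < L \<longrightarrow> gen a * X = gen b * Y \<longrightarrow>
     (\<exists>W. X = res a b * W \<and> Y = res b a * W))"

lemma lcm_belowD:
  assumes "lcm_below L" "gen a * X = gen b * Y" "len X < L"
  shows "a = b \<Longrightarrow> X = Y"
    and "a \<noteq> b \<Longrightarrow> adj a b \<Longrightarrow> \<exists>W. X = gen b * (gen a * W) \<and> Y = gen a * (gen b * W)"
    and "a \<noteq> b \<Longrightarrow> \<not> adj a b \<Longrightarrow> \<exists>W. X = gen b * W \<and> Y = gen a * W"
  using assms unfolding lcm_below_def res_def by (fastforce simp: adj_sym mult.assoc)+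

text \<open>Garside's cube condition: \<open>c\<close> is the first letter of an intermediate word in a chain of
  relations from \<open>a X\<close> to \<open>b Y\<close>.\<close>

lemma cube_aux:
  assumes L: "lcm_below L" and len: "len (res c a * U) = L"
    and eq: "res c a * U = res c b * V"
    and ne: "a \<noteq> b" "a \<noteq> c" "b \<noteq> c" and cb: "adj c b \<Longrightarrow> adj c a"
  shows "\<exists>W. res a c * U = res a b * W \<and> res b c * V = res b a * W"
proof -
  note H = lcm_belowD[OF L]
  note sy = adj_sym[of a c] adj_sym[of b c] adj_sym[of b a]
  have notriangle: "\<not> (adj c a \<and> adj c b \<and> adj a b)" using ne by (auto simp: adj_def)
  \<comment> \<open>Three indices are never pairwise adjacent, and \<open>cb\<close> excludes that c
    is adjacent to b only. In (1) and (4) the three letters form a path; their least common multiple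
    is the half twist on four strands, which is where the long words in these cases come
    from.\<close>
  consider (1) "adj c a" "adj c b" "\<not> adj a b" | (2) "adj c a" "\<not> adj c b" "\<not> adj a b"
    | (3) "\<not> adj c a" "\<not> adj c b" "adj a b" | (4) "adj c a" "\<not> adj c b" "adj a b"
    | (5) "\<not> adj c a" "\<not> adj c b" "\<not> adj a b"
    using cb notriangle by (cases "adj c a"; cases "adj c b"; cases "adj a b") auto
  then show ?thesis
  proof cases
    case 1
    note adj = 1 1[folded sy]
    have e: "gen a * (gen c * U) = gen b * (gen c * V)"
      using eq adj ne by (simp add: res_def mult.assoc)
    have l: "L = Suc (Suc (len U))"
      using len adj ne by (simp add: res_def)
    obtain W where W: "gen c * U = gen b * W" "gen c * V = gen a * W"
      using H(3)[OF e] ne adj l by auto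
    have lW: "len W = len U" "len V = len U"
      using W[THEN arg_cong[of _ _ len]] by simp_all
    obtain W1 where W1: "U = gen b * (gen c * W1)" "W = gen c * (gen b * W1)"
      using H(2)[OF W(1)] ne adj l by auto
    obtain W2 where W2: "V = gen a * (gen c * W2)" "W = gen c * (gen a * W2)"
      using H(2)[OF W(2)] ne adj l lW by auto
    have lens: "len U = Suc (Suc (len W1))" using W1 by simp
    have "gen b * W1 = gen a * W2"
      using H(1)[of c "gen b * W1" c "gen a * W2"] W1 W2 lens l by simp
    then obtain Q where Q: "W1 = gen a * Q" "W2 = gen b * Q"
      using H(3)[of b W1 a W2] ne adj lens l by auto
    have r: "gen a * (gen b * X) = gen b * (gen a * X)"
      "gen c * (gen a * (gen c * X)) = gen a * (gen c * (gen a * X))"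
      "gen c * (gen b * (gen c * X)) = gen b * (gen c * (gen b * X))" for X
      using adj gen_adj gen_nadj by auto
    have "gen c * (gen a * (gen b * (gen c * (gen a * Q)))) = gen b * (gen c * (gen b * (gen a * (gen c * Q))))"
      by (metis r)
    moreover have "gen c * (gen b * (gen a * (gen c * (gen b * Q)))) = gen a * (gen c * (gen b * (gen a * (gen c * Q))))"
      by (metis r)
    ultimately show ?thesis
      using adj ne by (intro exI[of _ "gen c * (gen b * (gen a * (gen c * Q)))"])
        (simp add: res_def mult.assoc W1 W2 Q)
  next
    case 2
    note adj = 2 2[folded sy]
    have e: "gen a * (gen c * U) = gen b * V"
      using eq adj ne by (simp add: res_def mult.assoc)
    have l: "L = Suc (Suc (len U))"
      using len adj ne by (simp add: res_def)
    obtain W where W: "gen c * U = gen b * W" "V = gen a * W"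
      using H(3)[OF e] ne adj l by auto
    obtain W' where W': "U = gen b * W'" "W = gen c * W'"
      using H(3)[OF W(1)] ne adj l by auto
    have r: "gen a * (gen b * X) = gen b * (gen a * X)"
      "gen c * (gen a * (gen c * X)) = gen a * (gen c * (gen a * X))"
      "gen c * (gen b * X) = gen b * (gen c * X)" for X
      using adj gen_adj gen_nadj by auto
    show ?thesis
      using adj ne r by (intro exI[of _ "gen c * (gen a * W')"]) (simp add: res_def mult.assoc W W')
  next
    case 3
    note adj = 3 3[folded sy]
    have e: "gen a * U = gen b * V"
      using eq adj ne by (simp add: res_def mult.assoc)
    have l: "L = Suc (len U)"
      using len adj ne by (simp add: res_def)
    obtain W where W: "U = gen b * (gen a * W)" "V = gen a * (gen b * W)"
      using H(2)[OF e] ne adj l by auto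
    have r: "gen c * (gen a * X) = gen a * (gen c * X)"
      "gen c * (gen b * X) = gen b * (gen c * X)" for X
      using adj gen_adj gen_nadj by auto
    show ?thesis
      using adj ne r by (intro exI[of _ "gen c * W"]) (simp add: res_def mult.assoc W)
  next
    case 4
    note adj = 4 4[folded sy]
    have e: "gen a * (gen c * U) = gen b * V"
      using eq adj ne by (simp add: res_def mult.assoc)
    have l: "L = Suc (Suc (len U))"
      using len adj ne by (simp add: res_def)
    obtain W where W: "gen c * U = gen b * (gen a * W)" "V = gen a * (gen b * W)"
      using H(2)[OF e] ne adj l by auto
    obtain Q where Q: "U = gen b * Q" "gen a * W = gen c * Q"
      using H(3)[OF W(1)] ne adj l by auto
    have lW: "Suc (len W) = len U" using W(1)[THEN arg_cong[of _ _ len]] by simp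
    obtain P where P: "W = gen c * (gen a * P)" "Q = gen a * (gen c * P)"
      using H(2)[OF Q(2)] ne adj l lW by auto
    have r: "gen a * (gen b * (gen a * X)) = gen b * (gen a * (gen b * X))"
      "gen c * (gen a * (gen c * X)) = gen a * (gen c * (gen a * X))"
      "gen c * (gen b * X) = gen b * (gen c * X)" for X
      using adj gen_adj gen_nadj by auto
    have "gen c * (gen a * (gen b * (gen a * (gen c * P)))) = gen b * (gen a * (gen c * (gen a * (gen b * P))))"
      by (metis r)
    moreover have "gen c * (gen a * (gen b * (gen c * (gen a * P)))) = gen a * (gen b * (gen c * (gen a * (gen b * P))))"
      by (metis r)
    ultimately show ?thesis
      using adj ne by (intro exI[of _ "gen c * (gen a * (gen b * P))"]) (simp add: res_def mult.assoc W Q P)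
  next
    case 5
    note adj = 5 5[folded sy]
    have e: "gen a * U = gen b * V"
      using eq adj ne by (simp add: res_def mult.assoc)
    have l: "L = Suc (len U)"
      using len adj ne by (simp add: res_def)
    obtain W where W: "U = gen b * W" "V = gen a * W"
      using H(3)[OF e] ne adj l by auto
    have r: "gen c * (gen a * X) = gen a * (gen c * X)"
      "gen c * (gen b * X) = gen b * (gen c * X)" for X
      using adj gen_adj gen_nadj by auto
    show ?thesis
      using adj ne r by (intro exI[of _ "gen c * W"]) (simp add: res_def mult.assoc W)
  qed
qed

text \<open>For \<open>a = b\<close> the claim amounts to cancelling \<open>res c a\<close>. For
  distinct letters the claim is symmetric in a and b, and one of the two orders satisfies the extra
  hypothesis of \<open>cube_aux\<close>.\<close>

lemma cube:
  assumes L: "lcm_below L" and len: "len (res c a * U) = L"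
    and eq: "res c a * U = res c b * V"
  shows "\<exists>W. res a c * U = res a b * W \<and> res b c * V = res b a * W"
proof -
  consider "a = c" | "b = c" | "a = b" "a \<noteq> c" | "a \<noteq> b" "a \<noteq> c" "b \<noteq> c" by blast
  then show ?thesis
  proof cases
    case 3
    have "U = V"
    proof (cases "adj c a")
      case True
      then have e: "gen a * (gen c * U) = gen a * (gen c * V)"
        using eq 3 by (simp add: res_def mult.assoc)
      moreover have "L = Suc (Suc (len U))" using len True 3 by (simp add: res_def)
      ultimately have e: "gen a * (gen c * U) = gen a * (gen c * V)" "L = Suc (Suc (len U))" .
      then have "gen c * U = gen c * V" using lcm_belowD(1)[OF L e(1)] by simp
      then show ?thesis using lcm_belowD(1)[OF L, of c U c V] e by simp
    next
      case False
      then have e: "gen a * U = gen a * V"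
        using eq 3 by (simp add: res_def)
      have "L = Suc (len U)" using len False 3 by (simp add: res_def)
      with e show ?thesis using lcm_belowD(1)[OF L e(1)] by simp
    qed
    with 3 show ?thesis by (simp add: res_def)
  next
    case 4
    show ?thesis
    proof (cases "adj c b \<longrightarrow> adj c a")
      case True
      then show ?thesis using cube_aux[OF L len eq] 4 by blast
    next
      case False
      then show ?thesis using cube_aux[OF L _ eq[symmetric]] len eq 4 by auto
    qed
  qed (use eq in \<open>auto simp: res_def\<close>)
qed

text \<open>Either the relation is applied at the front, and then it is the defining relation
  between a and c, or it leaves the first letter alone, and then \<open>a = c\<close> and both
  complements are trivial.\<close>

lemma step_head:
  assumes "braid_step (a # x) (c # z)"
  shows "\<exists>U. B.ev x = res a c * U \<and> B.ev z = res c a * U"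
  using assms
proof (cases rule: braid_step_cases)
  case (braid u i v)
  show ?thesis
  proof (cases u)
    case Nil
    with braid show ?thesis by (auto simp: res_def adj_def mult.assoc)
  next
    case (Cons k u')
    have "braid_step (u' @ [i, Suc i, i] @ v) (u' @ [Suc i, i, Suc i] @ v)"
      by (rule word_step.intros) (auto simp: braid_rels_def)
    with braid Cons have "a = c" "braid_step x z" by auto
    then show ?thesis by (auto simp: res_def ev_eq_iff intro: r_into_equivclp)
  qed
next
  case (far u i j v)
  show ?thesis
  proof (cases u)
    case Nil
    with far show ?thesis by (auto simp: res_def adj_def mult.assoc)
  next
    case (Cons k u')
    have "braid_step (u' @ [i, j] @ v) (u' @ [j, i] @ v)"
      by (rule word_step.intros) (use far(1) in \<open>auto simp: braid_rels_def\<close>)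
    with far Cons have "a = c" "braid_step x z" by auto
    then show ?thesis by (auto simp: res_def ev_eq_iff intro: r_into_equivclp)
  qed
qed

lemma braid_step_length: "braid_step u v \<Longrightarrow> length u = length v"
  by (rule braid_eq_length) (rule r_into_equivclp)

text \<open>The induction runs over the length of the words and, inside, over the length \<open>m\<close> of the
  chain of relations.\<close>

lemma lcm_chain:
  assumes L: "lcm_below (length x)"
  shows "(symclp braid_step ^^ m) (a # x) (b # y) \<Longrightarrow> \<exists>W. B.ev x = res a b * W \<and> B.ev y = res b a * W"
proof (induction m arbitrary: y b)
  case 0
  then show ?case by (simp add: res_def)
next
  case (Suc m)
  then obtain u where u: "(symclp braid_step ^^ m) (a # x) u" "symclp braid_step u (b # y)" by auto
  have "length u = length (b # y)" using u(2) braid_step_length[of u "b # y"] braid_step_length[of "b # y" u]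
    unfolding symclp_def by argo
  then obtain c z where c: "u = c # z" by (cases u) auto
  obtain U where U: "B.ev x = res a c * U" "B.ev z = res c a * U"
    using Suc.IH[of c z] u(1) c by auto
  obtain V where V: "B.ev z = res c b * V" "B.ev y = res b c * V"
    using u(2) c step_head[of c z b y] step_head[of b y c z] by (auto simp: symclp_def)
  \<comment> \<open>\<open>res a c\<close> and \<open>res c a\<close> have the same length, so
    \<open>cube\<close> applies at exactly the bound in \<open>L\<close>.\<close>
  have "len (res c a * U) = length x"
    using arg_cong[OF U(1), of len] by (simp add: res_def adj_def len_ev split: if_splits)
  then obtain W where W: "res a c * U = res a b * W \<and> res b c * V = res b a * W"
    using cube[OF L _ trans[OF U(2)[symmetric] V(1)]] by blast
  show ?case
    by (rule exI[of _ W]) (use U(1) V(2) W in simp)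
qed

lemma lcm_below: "lcm_below L"
proof (induction L)
  case 0
  then show ?case by (simp add: lcm_below_def)
next
  case (Suc L)
  show ?case unfolding lcm_below_def
  proof (intro allI impI)
    fix a b X Y assume l: "len X < Suc L" and eq: "gen a * X = gen b * Y"
    obtain x y where xy: "X = B.ev x" "Y = B.ev y" using ev_surj by meson
    have "B.ev (a # x) = B.ev (b # y)" using eq xy by simp
    then have "braid_eq (a # x) (b # y)" unfolding ev_eq_iff .
    then obtain m where "(symclp braid_step ^^ m) (a # x) (b # y)"
      unfolding equivclp_def by (auto dest: rtranclp_imp_relpowp)
    moreover have "lcm_below (length x)" using Suc l xy by (auto simp: lcm_below_def)
    ultimately show "\<exists>W. X = res a b * W \<and> Y = res b a * W"
      unfolding xy by (rule lcm_chain[rotated])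
  qed
qed

lemma gen_cancel: "gen a * X = gen a * Y \<Longrightarrow> X = Y"
  by (rule lcm_belowD(1)[OF lcm_below _ lessI]) auto

lemma lcm_adj: "gen a * X = gen b * Y \<Longrightarrow> adj a b \<Longrightarrow> \<exists>W. X = gen b * (gen a * W) \<and> Y = gen a * (gen b * W)"
  by (rule lcm_belowD(2)[OF lcm_below _ lessI]) (auto simp: adj_def)

lemma lcm_far: "gen a * X = gen b * Y \<Longrightarrow> Suc a < b \<or> Suc b < a \<Longrightarrow> \<exists>W. X = gen b * W \<and> Y = gen a * W"
  by (rule lcm_belowD(3)[OF lcm_below _ lessI]) (auto simp: adj_def)

lemma ev_cancel: "B.ev w * X = B.ev w * Y \<Longrightarrow> X = Y"
  by (induction w) (auto simp: mult.assoc dest: gen_cancel)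

lemma left_cancel: "(p :: braid_monoid) * X = p * Y \<Longrightarrow> X = Y"
  using ev_cancel ev_surj by metis

section \<open>Divisibility by the half twist and the center of the positive braid monoid\<close>

lemma lcm_far_ev:
  "(\<And>j. j \<in> set w \<Longrightarrow> Suc i < j \<or> Suc j < i) \<Longrightarrow> B.ev w * Y = gen i * Z \<Longrightarrow> \<exists>W. Y = gen i * W"
proof (induction w arbitrary: Z)
  case (Cons a w)
  have "Suc a < i \<or> Suc i < a" using Cons.prems(1)[of a] by auto
  then obtain W where "B.ev w * Y = gen i * W"
    using lcm_far[of a "B.ev w * Y" i Z] Cons.prems(2) by (auto simp: mult.assoc)
  then show ?case using Cons.IH Cons.prems(1) by simp
qed auto

text \<open>The word k + 1, ..., 1 is the complement of k, ..., 1 in its least common multiple with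
  the letter k + 1. Comparing the leading letters k + 1 and k + 2 lets k + 2 pass the far letters to
  the front of Y and leaves the same problem one index lower.\<close>

lemma desc_dvd:
  "B.ev (desc_word k) * Y = gen (Suc k) * Z \<Longrightarrow> \<exists>W. Y = B.ev (desc_word (Suc k)) * W"
proof (induction k arbitrary: Y Z)
  case 0
  then show ?case by auto
next
  case (Suc k)
  have "gen (Suc k) * (B.ev (desc_word k) * Y) = gen (Suc (Suc k)) * Z"
    using Suc.prems by (simp add: mult.assoc)
  then obtain V where V: "B.ev (desc_word k) * Y = gen (Suc (Suc k)) * (gen (Suc k) * V)"
    using lcm_adj by (force simp: adj_def)
  then obtain Y' where Y': "Y = gen (Suc (Suc k)) * Y'"
    using lcm_far_ev[OF _ V] by (force simp: set_desc_word)
  have "gen (Suc (Suc k)) * (B.ev (desc_word k) * Y') = B.ev (desc_word k) * Y"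
    unfolding Y' mult.assoc[symmetric]
    by (subst B.s_far_ev) (auto simp: set_desc_word)
  also note V
  finally obtain W where "Y' = B.ev (desc_word (Suc k)) * W"
    using Suc.IH gen_cancel by blast
  then show ?case using Y' by (auto simp: mult.assoc)
qed

text \<open>The half twist is the least common multiple of its letters. In the inductive step the
  new letter k + 1 is far from everything in the half twist except its last descending word, where
  \<open>desc_dvd\<close> applies.\<close>

lemma half_twist_dvd:
  "(\<And>i. 1 \<le> i \<Longrightarrow> i \<le> k \<Longrightarrow> \<exists>y. p = gen i * y) \<Longrightarrow> \<exists>q. p = B.ev (half_twist_word k) * q"
proof (induction k)
  case (Suc k)
  then obtain q where q: "p = B.ev (half_twist_word k) * q" by auto
  obtain y where y: "p = gen (Suc k) * y" using Suc.prems by auto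
  have "\<exists>z. B.ev (desc_word k) * q = gen (Suc k) * z"
  proof (cases k)
    case 0
    then show ?thesis using q y by auto
  next
    case (Suc j)
    then have "B.ev (half_twist_word j) * (B.ev (desc_word k) * q) = gen (Suc k) * y"
      using q y by (simp add: mult.assoc)
    then show ?thesis
      by (rule lcm_far_ev[rotated]) (auto simp: set_half_twist_word Suc)
  qed
  then obtain W where "q = B.ev (desc_word (Suc k)) * W"
    using desc_dvd by blast
  then show ?case unfolding q by (auto simp: mult.assoc)
qed simp

text \<open>If a divides p and b is adjacent to a, then b p = p \<phi>(b) is a common multiple of a
  and b, so p begins with a b. Cancelling a in a p = p \<phi>(a) then exhibits b in front of p. All
  indices are reached through neighbours.\<close>

lemma twisted_central_dvd:
  assumes tw: "\<And>i. 1 \<le> i \<Longrightarrow> i \<le> m \<Longrightarrow> gen i * p = p * gen (\<phi> i)"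
    and i: "1 \<le> i" "i \<le> m" "p = gen i * y" and j: "1 \<le> j" "j \<le> m"
  shows "\<exists>y. p = gen j * y"
proof -
  have step: "\<exists>y. p = gen b * y"
    if ab: "adj b a" "1 \<le> a" "a \<le> m" "1 \<le> b" "b \<le> m" "\<exists>y. p = gen a * y" for a b
  proof -
    obtain y where y: "p = gen a * y" using ab(6) ..
    have "gen b * p = gen a * (y * gen (\<phi> b))" using tw[of b] ab y by (simp add: mult.assoc)
    then obtain W where W: "p = gen a * (gen b * W)" using lcm_adj ab by blast
    have "gen a * p = gen a * (gen b * (W * gen (\<phi> a)))" using tw[of a] ab W by (simp add: mult.assoc)
    then show ?thesis using gen_cancel by blast
  qed
  have up: "\<exists>y. p = gen (i + d) * y" if "i + d \<le> m" for d
    using that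
  proof (induction d)
    case (Suc d)
    then show ?case using step[of "i + Suc d" "i + d"] i by (auto simp: adj_def)
  qed (use i in auto)
  have down: "\<exists>y. p = gen (i - d) * y" if "d < i" for d
    using that
  proof (induction d)
    case (Suc d)
    have "adj (i - Suc d) (i - d)" using Suc.prems by (auto simp: adj_def)
    moreover have "\<exists>y. p = gen (i - d) * y" using Suc by auto
    ultimately show ?case using step[of "i - Suc d" "i - d"] Suc.prems i by auto
  qed (use i in auto)
  show ?thesis using up[of "j - i"] down[of "i - j"] i j by (cases "i \<le> j") auto
qed

text \<open>Dividing by one half twist reverses the indices, so centrality does not survive the
  induction. Commutation up to a relabelling \<phi> does, with \<phi> changing from step to
  step.\<close>

lemma twisted_central:
  assumes "1 \<le> m" "letters p \<subseteq> {1..m}"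
    and "\<And>i. 1 \<le> i \<Longrightarrow> i \<le> m \<Longrightarrow> gen i * p = p * gen (\<phi> i)"
  shows "\<exists>k. p = B.ev (half_twist_word m) ^ k"
  using assms
proof (induction "len p" arbitrary: p \<phi> rule: less_induct)
  case less
  obtain w where w: "p = B.ev w" using ev_surj by auto
  show ?case
  proof (cases w)
    case Nil
    then show ?thesis using w by (intro exI[of _ 0]) simp
  next
    case (Cons a v)
    then have a: "1 \<le> a" "a \<le> m" "p = gen a * B.ev v" using less.prems(2) w by auto
    then have "\<exists>y. p = gen i * y" if "1 \<le> i" "i \<le> m" for i
      using twisted_central_dvd[OF less.prems(3) a] that by blast
    then obtain q where q: "p = B.ev (half_twist_word m) * q"
      using half_twist_dvd by blast
    have tw: "gen i * q = q * gen (\<phi> (Suc m - i))" if i: "1 \<le> i" "i \<le> m" for i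
    proof (rule left_cancel)
      have i': "1 \<le> Suc m - i" "Suc m - i \<le> m" "Suc m - (Suc m - i) = i" using i by auto
      have "B.ev (half_twist_word m) * (gen i * q) = gen (Suc m - i) * p"
        unfolding q using B.x_half_twist[OF i'(1,2)] i'(3) by (simp flip: mult.assoc)
      also have "\<dots> = B.ev (half_twist_word m) * (q * gen (\<phi> (Suc m - i)))"
        using less.prems(3)[OF i'(1,2)] q by (simp add: mult.assoc)
      finally show "B.ev (half_twist_word m) * (gen i * q)
        = B.ev (half_twist_word m) * (q * gen (\<phi> (Suc m - i)))" .
    qed
    have "half_twist_word m \<noteq> []" using less.prems(1) by (cases m) auto
    then have "len q < len p" "letters q \<subseteq> {1..m}" using q less.prems(2) by auto
    from less.hyps[OF this(1) less.prems(1) this(2) tw]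
    obtain k where "q = B.ev (half_twist_word m) ^ k" by blast
    then have "p = B.ev (half_twist_word m) ^ Suc k" unfolding q by simp
    then show ?thesis by blast
  qed
qed

definition full_twist_word :: "nat \<Rightarrow> nat list" where
  "full_twist_word m = half_twist_word m @ half_twist_word m"

lemma full_twist_gen: "1 \<le> i \<Longrightarrow> i \<le> m \<Longrightarrow> gen i * B.ev (full_twist_word m) = B.ev (full_twist_word m) * gen i"
  using B.x_full_twist by (simp add: full_twist_word_def)

lemma full_twist_commutes:
  "letters p \<subseteq> {1..m} \<Longrightarrow> p * B.ev (full_twist_word m) = B.ev (full_twist_word m) * p"
proof -
  have "set w \<subseteq> {1..m} \<Longrightarrow> B.ev w * B.ev (full_twist_word m) = B.ev (full_twist_word m) * B.ev w" for w
  proof (induction w)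
    case (Cons a w)
    have "B.ev (a # w) * B.ev (full_twist_word m) = (gen a * B.ev (full_twist_word m)) * B.ev w"
      using Cons by (simp add: mult.assoc)
    also have "gen a * B.ev (full_twist_word m) = B.ev (full_twist_word m) * gen a"
      using Cons by (intro full_twist_gen) auto
    finally show ?case by (simp add: mult.assoc)
  qed simp
  then show "letters p \<subseteq> {1..m} \<Longrightarrow> ?thesis" using ev_surj letters_ev by metis
qed

text \<open>An odd power of the half twist cannot be central: it would have to commute with the
  letter 1, which it turns into m, and these differ for m >= 2.\<close>

lemma braid_monoid_center:
  assumes m: "2 \<le> m" and p: "letters p \<subseteq> {1..m}"
    and c: "\<And>i. 1 \<le> i \<Longrightarrow> i \<le> m \<Longrightarrow> gen i * p = p * gen i"
  shows "\<exists>k. p = B.ev (full_twist_word m) ^ k"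
proof -
  define D where "D = B.ev (half_twist_word m)"
  obtain k where k: "p = D ^ k" using twisted_central[OF _ p, of id] m c unfolding D_def by auto
  have E: "B.ev (full_twist_word m) = D ^ 2" by (simp add: full_twist_word_def D_def power2_eq_square)
  show ?thesis
  proof (cases "even k")
    case True
    then show ?thesis using k E by (auto simp: power_mult elim!: evenE)
  next
    case False
    then obtain j where j: "p = D ^ (2 * j) * D" using k by (auto elim!: oddE simp flip: power_Suc2)
    have "gen 1 * D ^ (2 * i) = D ^ (2 * i) * gen 1" for i
    proof (induction i)
      case (Suc i)
      have "gen 1 * D ^ (2 * Suc i) = (gen 1 * D ^ 2) * D ^ (2 * i)"
        by (simp add: power_add power2_eq_square mult.assoc)
      also have "gen 1 * D ^ 2 = D ^ 2 * gen 1" using full_twist_gen[of 1 m] m E by simp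
      finally show ?case using Suc by (simp add: power2_eq_square mult.assoc)
    qed simp
    then have "D ^ (2 * j) * (gen 1 * D) = gen 1 * p" unfolding j by (simp flip: mult.assoc)
    also have "\<dots> = D ^ (2 * j) * (D * gen 1)" using c[of 1] m j by (simp add: mult.assoc)
    finally have "gen 1 * D = D * gen 1" by (rule left_cancel)
    moreover have "gen 1 * D = D * gen m" using B.x_half_twist[of 1 m] m by (simp add: D_def)
    ultimately have "gen 1 = gen m" using left_cancel[of D "gen 1" "gen m"] by simp
    then have "letters (gen 1) = letters (gen m)" by simp
    then show ?thesis using m by simp
  qed
qed

section \<open>The full twist in the singular braid group\<close>

definition sing_rels :: "(sgen list \<times> sgen list) set" where
  "sing_rels = {([Sig i, Sig (Suc i), Sig i], [Sig (Suc i), Sig i, Sig (Suc i)]) | i. True}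
    \<union> {([Sig i, Sig j], [Sig j, Sig i]) | i j. Suc i < j}
    \<union> {([Tau i, Sig j], [Sig j, Tau i]) | i j. Suc i < j \<or> Suc j < i}
    \<union> {([Tau i, Sig i], [Sig i, Tau i]) | i. True}
    \<union> {([Sig i, Sig (Suc i), Tau i], [Tau (Suc i), Sig i, Sig (Suc i)]) | i. True}
    \<union> {([Sig (Suc i), Sig i, Tau (Suc i)], [Tau i, Sig (Suc i), Sig i]) | i. True}"

text \<open>The relations between two \<open>\<tau>\<close>'s are left out of \<open>sing_rels\<close>:
  centrality of the full twist does not depend on them.\<close>

quotient_type sing_monoid = "sgen list" / "word_eq sing_rels"
  by (rule equivp_word_eq)

instantiation sing_monoid :: monoid_mult
begin

lift_definition one_sing_monoid :: sing_monoid is "[]" .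
lift_definition times_sing_monoid :: "sing_monoid \<Rightarrow> sing_monoid \<Rightarrow> sing_monoid" is "(@)"
  by (rule word_eq_append)

instance by standard (transfer; simp)+

end

lift_definition sgen_elem :: "sgen \<Rightarrow> sing_monoid" is "\<lambda>x. [x]" .

interpretation SM: braid_pair "\<lambda>i. sgen_elem (Sig i)" "\<lambda>i. sgen_elem (Tau i)"
  by unfold_locales (transfer, auto simp: sing_rels_def intro!: word_eq_rel)+

lemma abs_sing_monoid: "abs_sing_monoid (map Sig w) = SM.ev w"
proof (induction w)
  case Nil
  then show ?case by (simp only: one_sing_monoid.abs_eq[symmetric] SM.ev_simps list.map)
next
  case (Cons a w)
  have "abs_sing_monoid (map Sig (a # w)) = abs_sing_monoid [Sig a] * abs_sing_monoid (map Sig w)"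
    by (simp only: times_sing_monoid.abs_eq append.simps list.map)
  then show ?case by (simp only: sgen_elem.abs_eq[symmetric] Cons SM.ev_simps)
qed

lemma tau_full_twist:
  assumes "1 \<le> i" "i \<le> m"
  shows "word_eq sing_rels (Tau i # map Sig (full_twist_word m)) (map Sig (full_twist_word m) @ [Tau i])"
proof -
  have "abs_sing_monoid [Tau i] * abs_sing_monoid (map Sig (full_twist_word m))
      = abs_sing_monoid (map Sig (full_twist_word m)) * abs_sing_monoid [Tau i]"
    using SM.x_full_twist[OF assms]
    by (simp add: abs_sing_monoid sgen_elem.abs_eq[symmetric] full_twist_word_def del: map_append)
  then have "abs_sing_monoid ([Tau i] @ map Sig (full_twist_word m))
      = abs_sing_monoid (map Sig (full_twist_word m) @ [Tau i])"
    by (simp only: times_sing_monoid.abs_eq)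
  then show ?thesis by (simp only: sing_monoid.abs_eq_iff append.simps)
qed

text \<open>Relations between positive words with indices in the range of \<open>SG\<^sub>n\<close> carry over
  from the monoid, in which the indices are unbounded.\<close>

lemma word_eq_pres_cong:
  assumes "word_eq Q u v" "set u \<subseteq> A" "f ` A \<subseteq> S"
    and sets: "\<And>l r. (l, r) \<in> Q \<Longrightarrow> set l \<subseteq> A \<longleftrightarrow> set r \<subseteq> A"
    and rels: "\<And>l r. (l, r) \<in> Q \<Longrightarrow> set l \<subseteq> A \<Longrightarrow> (pos_word (map f l), pos_word (map f r)) \<in> pres_cong S R"
  shows "(pos_word (map f u), pos_word (map f v)) \<in> pres_cong S R"
proof -
  have gw: "pos_word (map f w) \<in> gwords S" if "set w \<subseteq> A" for w
    using that assms(3) by (induction w) (auto simp: pos_word_def)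
  have one: "(pos_word (map f y), pos_word (map f z)) \<in> pres_cong S R"
    if st: "word_step Q y z" and y: "set y \<subseteq> A" for y z
    using st
  proof cases
    case (1 l r a b)
    have "(pos_word (map f l), pos_word (map f r)) \<in> pres_cong S R"
      using rels 1 y by auto
    then have "(pos_word (map f a) @ pos_word (map f l) @ pos_word (map f b),
        pos_word (map f a) @ pos_word (map f r) @ pos_word (map f b)) \<in> pres_cong S R"
      using gw y 1 by (intro pres_cong.compat pres_cong.reflexive) auto
    then show ?thesis using 1 by (simp add: pos_word_def)
  qed
  have sub: "set z \<subseteq> A \<longleftrightarrow> set y \<subseteq> A" if "word_step Q y z" for y z
    using that by cases (use sets in auto)
  from assms(1) have "(pos_word (map f u), pos_word (map f v)) \<in> pres_cong S R \<and> set v \<subseteq> A"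
  proof (induction rule: equivclp_induct)
    case base
    then show ?case using gw assms(2) by (auto intro: pres_cong.reflexive)
  next
    case (step y z)
    then have "set z \<subseteq> A" using sub[of y z] sub[of z y] by blast
    moreover have "(pos_word (map f y), pos_word (map f z)) \<in> pres_cong S R"
      using step(2)
    proof
      assume "word_step Q y z"
      then show ?thesis using one step by blast
    next
      assume "word_step Q z y"
      then show ?thesis using one[of z y] \<open>set z \<subseteq> A\<close> by (blast intro: pres_cong.symmetric)
    qed
    ultimately show ?case using step.IH by (blast intro: pres_cong.transitive)
  qed
  then show ?thesis ..
qed

section \<open>Positive words in the singular braid group and the central full twist\<close>

locale sing_braid =
  fixes n :: nat
  assumes n: "n \<ge> 3"
begin

abbreviation "S \<equiv> sing_braid_gens n"
abbreviation "R \<equiv> sing_braid_rels n"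
abbreviation "G \<equiv> sing_braid_group n"
abbreviation "PC \<equiv> pres_cong S R"
abbreviation cls :: "sgen gword \<Rightarrow> sgen gword set" where "cls \<equiv> pres_class S R"
abbreviation sw :: "nat list \<Rightarrow> sgen gword" where "sw u \<equiv> pos_word (map Sig u)"

sublocale G: group G by (rule group_sing_braid_group)

lemma in_S [simp]: "Sig i \<in> S \<longleftrightarrow> 1 \<le> i \<and> i \<le> n - 1" "Tau i \<in> S \<longleftrightarrow> 1 \<le> i \<and> i \<le> n - 1"
  by (auto simp: sing_braid_gens_def)

lemma G_carrier: "carrier G = cls ` gwords S"
  by (simp add: sing_braid_group_def pres_group_carrier)

lemma cls_closed [simp, intro]: "u \<in> gwords S \<Longrightarrow> cls u \<in> carrier G"
  by (auto simp: G_carrier)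

lemma cls_append: "u \<in> gwords S \<Longrightarrow> v \<in> gwords S \<Longrightarrow> cls (u @ v) = cls u \<otimes>\<^bsub>G\<^esub> cls v"
  by (simp add: sing_braid_group_def pres_group_mult)

lemma cls_Nil: "cls [] = \<one>\<^bsub>G\<^esub>"
  by (simp add: sing_braid_group_def pres_group_one)

lemma cls_eq_iff: "u \<in> gwords S \<Longrightarrow> v \<in> gwords S \<Longrightarrow> cls u = cls v \<longleftrightarrow> (u, v) \<in> PC"
  by (rule pres_class_eq_iff)

lemma cls_eqI: "(u, v) \<in> PC \<Longrightarrow> cls u = cls v"
  using cls_eq_iff pres_cong_gwords by metis

lemma cls_inv: "x \<in> S \<Longrightarrow> cls [(x, False)] = inv\<^bsub>G\<^esub> cls [(x, True)]"
proof -
  assume x: "x \<in> S"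
  have "cls ([(x, False)] @ [(x, True)]) = \<one>\<^bsub>G\<^esub>"
    using pres_cong.cancel[OF x, of False R] x by (simp add: cls_Nil[symmetric] cls_eq_iff)
  then have "cls [(x, False)] \<otimes>\<^bsub>G\<^esub> cls [(x, True)] = \<one>\<^bsub>G\<^esub>"
    using x by (subst (asm) cls_append) simp_all
  then show ?thesis using x by (intro G.inv_equality[symmetric]) auto
qed

lemma sw_gwords [simp]: "sw u \<in> gwords S \<longleftrightarrow> set u \<subseteq> {1..n - Suc 0}"
  by (induction u) (auto simp: pos_word_def)

lemma sw_append: "sw (u @ v) = sw u @ sw v"
  by (simp add: pos_word_def)

lemma pos_pair: "(l, r) \<in> X \<Longrightarrow> (pos_word l, pos_word r) \<in> map_prod pos_word pos_word ` X"
  by force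

lemma rel_sing:
  assumes "(l, r) \<in> sing_rels" "set l \<subseteq> S"
  shows "(pos_word l, pos_word r) \<in> PC"
proof (rule pres_cong.rel)
  show "(pos_word l, pos_word r) \<in> R"
    unfolding sing_braid_rels_def by (rule pos_pair) (use assms in \<open>auto simp: sing_rels_def\<close>)
  show "pos_word l \<in> gwords S" "pos_word r \<in> gwords S"
    using assms by (auto simp: sing_rels_def pos_word_def)
qed

lemma sing_rels_S: "(l, r) \<in> sing_rels \<Longrightarrow> set l \<subseteq> S \<longleftrightarrow> set r \<subseteq> S"
  by (auto simp: sing_rels_def)

lemma sing_eq_cls: "word_eq sing_rels u v \<Longrightarrow> set u \<subseteq> S \<Longrightarrow> cls (pos_word u) = cls (pos_word v)"
  using word_eq_pres_cong[where Q = sing_rels and A = S and f = id and S = S and R = R]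
    rel_sing sing_rels_S
  by (intro cls_eqI) (simp add: subset_iff)

lemma braid_eq_cls:
  assumes "B.ev u = B.ev v" "set u \<subseteq> {1..n-1}"
  shows "cls (sw u) = cls (sw v)"
proof (rule cls_eqI, rule word_eq_pres_cong)
  show "braid_eq u v" using assms(1) by (simp add: ev_eq_iff)
  show "set u \<subseteq> {1..n-1}" by (rule assms(2))
  show "Sig ` {1..n-1} \<subseteq> S" by auto
  show "set l \<subseteq> {1..n-1} \<longleftrightarrow> set r \<subseteq> {1..n-1}" if "(l, r) \<in> braid_rels" for l r
    using that by (auto simp: braid_rels_def)
  show "(sw l, sw r) \<in> PC" if "(l, r) \<in> braid_rels" "set l \<subseteq> {1..n-1}" for l r
  proof (rule rel_sing)
    show "(map Sig l, map Sig r) \<in> sing_rels"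
      using that(1) by (auto simp: braid_rels_def sing_rels_def)
    show "set (map Sig l) \<subseteq> S" using that(2) by auto
  qed
qed

abbreviation "ft \<equiv> full_twist_word (n - 1)"

definition twist :: "sgen gword set" where "twist = cls (sw ft)"

lemma set_ft: "set (full_twist_word k) = {1..k}"
  by (simp add: full_twist_word_def set_half_twist_word)

lemma twist_closed [simp, intro]: "twist \<in> carrier G"
  unfolding twist_def by (rule cls_closed) (simp add: set_ft)

lemma commutes_gens_center:
  assumes z: "z \<in> carrier G" and c: "\<And>x. x \<in> S \<Longrightarrow> z \<otimes>\<^bsub>G\<^esub> cls [(x, True)] = cls [(x, True)] \<otimes>\<^bsub>G\<^esub> z"
  shows "z \<in> group_center G"
proof -
  have "z \<otimes>\<^bsub>G\<^esub> cls w = cls w \<otimes>\<^bsub>G\<^esub> z" if "w \<in> gwords S" for w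
    using that
  proof (induction w)
    case Nil
    then show ?case using z by (simp add: cls_Nil)
  next
    case (Cons a w)
    obtain x b where a: "a = (x, b)" by fastforce
    have x: "x \<in> S" and w: "w \<in> gwords S" using Cons a by auto
    have g: "cls [(x, True)] \<in> carrier G" using x by auto
    have "z \<otimes>\<^bsub>G\<^esub> inv\<^bsub>G\<^esub> cls [(x, True)] = inv\<^bsub>G\<^esub> cls [(x, True)] \<otimes>\<^bsub>G\<^esub> z"
    proof -
      let ?g = "cls [(x, True)]"
      have "z \<otimes>\<^bsub>G\<^esub> inv\<^bsub>G\<^esub> ?g = inv\<^bsub>G\<^esub> ?g \<otimes>\<^bsub>G\<^esub> ?g \<otimes>\<^bsub>G\<^esub> z \<otimes>\<^bsub>G\<^esub> inv\<^bsub>G\<^esub> ?g"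
        using z g by simp
      also have "\<dots> = inv\<^bsub>G\<^esub> ?g \<otimes>\<^bsub>G\<^esub> (z \<otimes>\<^bsub>G\<^esub> ?g) \<otimes>\<^bsub>G\<^esub> inv\<^bsub>G\<^esub> ?g"
        unfolding c[OF x] using z g by (simp only: G.m_assoc G.m_closed G.inv_closed)
      also have "\<dots> = inv\<^bsub>G\<^esub> ?g \<otimes>\<^bsub>G\<^esub> z"
        using z g by (simp add: G.m_assoc)
      finally show ?thesis .
    qed
    then have 1: "z \<otimes>\<^bsub>G\<^esub> cls [a] = cls [a] \<otimes>\<^bsub>G\<^esub> z" using c[OF x] x by (cases b) (auto simp: a cls_inv)
    have ca: "cls [a] \<in> carrier G" "cls w \<in> carrier G" using x w by (auto simp: a)
    have aw: "cls (a # w) = cls [a] \<otimes>\<^bsub>G\<^esub> cls w"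
      using cls_append[of "[a]" w] x w a by simp
    have "z \<otimes>\<^bsub>G\<^esub> cls (a # w) = (z \<otimes>\<^bsub>G\<^esub> cls [a]) \<otimes>\<^bsub>G\<^esub> cls w"
      unfolding aw using ca z by (simp add: G.m_assoc)
    also have "\<dots> = cls [a] \<otimes>\<^bsub>G\<^esub> (z \<otimes>\<^bsub>G\<^esub> cls w)"
      unfolding 1 using ca z by (simp add: G.m_assoc)
    also have "\<dots> = cls (a # w) \<otimes>\<^bsub>G\<^esub> z"
      unfolding aw Cons.IH[OF w] using ca z by (simp add: G.m_assoc)
    finally show ?case .
  qed
  then show ?thesis using z by (auto simp: group_center_def G_carrier)
qed

lemma twist_central: "twist \<in> group_center G"
proof (rule commutes_gens_center[OF twist_closed])
  fix x assume x: "x \<in> S"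
  have gw: "sw ft \<in> gwords S" by (simp add: set_ft)
  have "cls ([(x, True)] @ sw ft) = cls (sw ft @ [(x, True)])"
  proof (cases x)
    case (Sig i)
    have "cls (sw ([i] @ ft)) = cls (sw (ft @ [i]))"
      using x Sig by (intro braid_eq_cls) (auto simp: set_ft full_twist_gen)
    then show ?thesis by (simp add: Sig pos_word_def)
  next
    case (Tau i)
    have "cls (pos_word (Tau i # map Sig ft)) = cls (pos_word (map Sig ft @ [Tau i]))"
      using x Tau by (intro sing_eq_cls tau_full_twist) (auto simp: set_ft)
    then show ?thesis by (simp add: Tau pos_word_def)
  qed
  then show "twist \<otimes>\<^bsub>G\<^esub> cls [(x, True)] = cls [(x, True)] \<otimes>\<^bsub>G\<^esub> twist"
    using x gw unfolding twist_def by (simp only: cls_append[symmetric] gwords_simps fst_conv)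
qed

end

text \<open>The half twist begins with the letter 1 and is central up to reversal by
  \<open>x_half_twist\<close>; hence \<open>twisted_central_dvd\<close> spreads divisibility to all
  letters.\<close>

lemma half_twist_gen_dvd:
  assumes "1 \<le> j" "j \<le> k"
  shows "\<exists>y. B.ev (half_twist_word k) = gen j * y"
proof -
  have first: "\<exists>w. half_twist_word (Suc l) = 1 # w" for l
  proof (induction l)
    case (Suc l)
    then obtain w where "half_twist_word (Suc l) = 1 # w" ..
    then show ?case unfolding half_twist_word.simps(2)[of "Suc l"] by simp
  qed simp
  obtain l where "k = Suc l" using assms by (cases k) auto
  with first obtain w where "half_twist_word k = 1 # w" by blast
  then have "B.ev (half_twist_word k) = gen 1 * B.ev w" by simp
  then show ?thesis
    by (rule twisted_central_dvd[where \<phi> = "\<lambda>i. Suc k - i", OF B.x_half_twist, rotated 4]) (use assms in auto)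
qed

lemma pos_word_single [simp]: "pos_word [x] = [(x, True)]"
  by (simp add: pos_word_def)

section \<open>Braids as fractions with powers of the full twist as denominators\<close>

fun sgen_index :: "sgen \<Rightarrow> nat" where
  "sgen_index (Sig i) = i"
| "sgen_index (Tau i) = i"

text \<open>The retraction \<open>\<tau>\<^sub>i \<mapsto> \<sigma>\<^sub>i\<close> of \<open>SG\<^sub>n\<close> onto the image of the braid group, on words.\<close>

definition desing :: "sgen gword \<Rightarrow> sgen gword" where
  "desing w = map (map_prod (Sig \<circ> sgen_index) id) w"

lemma desing_simps [simp]: "desing [] = []" "desing ((x, b) # w) = (Sig (sgen_index x), b) # desing w"
  "desing (u @ v) = desing u @ desing v"
  by (simp_all add: desing_def)

text \<open>The positive braid that represents the full twist times the inverse of sigma_i. It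
  exists for i in range because sigma_i divides the half twist, and cancellation makes it
  unique.\<close>

definition complement :: "nat \<Rightarrow> nat \<Rightarrow> braid_monoid" where
  "complement k i = (SOME y. B.ev (full_twist_word k) = gen i * y)"

text \<open>The product of \<open>w\<close> and the \<open>length w\<close>-th power of the full twist, which is positive.\<close>

definition clear :: "nat \<Rightarrow> sgen gword \<Rightarrow> braid_monoid" where
  "clear k w = prod_list (map (\<lambda>(x, b). if b then B.ev (full_twist_word k) * gen (sgen_index x)
     else complement k (sgen_index x)) w)"

lemma clear_simps [simp]: "clear k [] = 1"
  "clear k ((x, b) # w) = (if b then B.ev (full_twist_word k) * gen (sgen_index x)
     else complement k (sgen_index x)) * clear k w"
  "clear k (u @ v) = clear k u * clear k v"
  by (simp_all add: clear_def)

lemma gen_complement: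
  assumes "1 \<le> i" "i \<le> k"
  shows "gen i * complement k i = B.ev (full_twist_word k)"
    and "complement k i * gen i = B.ev (full_twist_word k)"
proof -
  obtain y where "B.ev (half_twist_word k) = gen i * y" using half_twist_gen_dvd[OF assms] ..
  then have "B.ev (full_twist_word k) = gen i * (y * B.ev (half_twist_word k))"
    by (simp add: full_twist_word_def mult.assoc)
  then show 1: "gen i * complement k i = B.ev (full_twist_word k)"
    unfolding complement_def by (metis (mono_tags, lifting) someI)
  have "gen i * (complement k i * gen i) = gen i * B.ev (full_twist_word k)"
    using 1 full_twist_gen[OF assms] by (simp flip: mult.assoc)
  then show "complement k i * gen i = B.ev (full_twist_word k)" by (rule gen_cancel)
qed

lemma gen_far_abs: "\<bar>int i - int j\<bar> \<ge> 2 \<Longrightarrow> gen i * gen j = gen j * gen i"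
  using B.x_far[of i j] by linarith

lemma letters_complement:
  assumes "1 \<le> i" "i \<le> k" shows "letters (complement k i) \<subseteq> {1..k}"
  using arg_cong[OF gen_complement(1)[OF assms], of letters]
  by (auto simp: full_twist_word_def set_half_twist_word)

text \<open>All that \<open>clear\<close> and the linear part of \<open>act\<close> have to know
  about a relation: both sides are positive of equal length and have the same underlying
  braid.\<close>

lemma sing_braid_rels_index:
  assumes "(u, v) \<in> sing_braid_rels n"
  shows "\<exists>xs ys. u = pos_word xs \<and> v = pos_word ys \<and> length xs = length ys
    \<and> B.ev (map sgen_index xs) = B.ev (map sgen_index ys)"
  using assms unfolding sing_braid_rels_def
  by (elim imageE UnE) (auto simp: gen_far_abs gen_braid intro!: exI)

context sing_braid begin

definition E :: braid_monoid where "E = B.ev ft"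

lemma E_comm: "letters p \<subseteq> {1..n-1} \<Longrightarrow> p * E ^ k = E ^ k * p"
  by (rule power_commuting_commutes[symmetric]) (simp add: E_def full_twist_commutes)

lemma sgen_index_S: "x \<in> S \<Longrightarrow> 1 \<le> sgen_index x \<and> sgen_index x \<le> n - 1"
  by (cases x) auto

lemma letters_clear: "w \<in> gwords S \<Longrightarrow> letters (clear (n-1) w) \<subseteq> {1..n-1}"
proof (induction w)
  case (Cons a w)
  obtain x b where a: "a = (x, b)" by fastforce
  have "1 \<le> sgen_index x" "sgen_index x \<le> n - 1" using Cons a sgen_index_S by auto
  then show ?case using Cons letters_complement[of "sgen_index x" "n - 1"]
    by (auto simp: a set_ft)
qed simp

lemma clear_pos:
  "set xs \<subseteq> S \<Longrightarrow> clear (n-1) (pos_word xs) = E ^ length xs * B.ev (map sgen_index xs)"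
proof (induction xs)
  case (Cons x xs)
  then have x: "1 \<le> sgen_index x" "sgen_index x \<le> n - 1" using sgen_index_S by auto
  have "clear (n-1) (pos_word (x # xs)) = E * (gen (sgen_index x) * E ^ length xs) * B.ev (map sgen_index xs)"
    using Cons by (simp add: pos_word_def E_def mult.assoc)
  also have "gen (sgen_index x) * E ^ length xs = E ^ length xs * gen (sgen_index x)"
    using x by (intro E_comm) auto
  finally show ?case by (simp add: mult.assoc)
qed (simp add: pos_word_def)

lemma pos_word_S: "pos_word xs \<in> gwords S \<Longrightarrow> set xs \<subseteq> S"
  by (induction xs) (auto simp: pos_word_def)

text \<open>Equality of two fractions with denominators \<open>E ^ length u\<close> and
  \<open>E ^ length v\<close>, cross-multiplied. It plays the part of a homomorphism to the group of
  fractions, with centrality of E and left cancellation in place of inverses.\<close>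

lemma clear_cong:
  "(u, v) \<in> PC \<Longrightarrow> E ^ length v * clear (n-1) u = E ^ length u * clear (n-1) v"
proof (induction rule: pres_cong.induct)
  case (rel u v)
  then obtain xs ys where "u = pos_word xs" "v = pos_word ys" "length xs = length ys"
    "B.ev (map sgen_index xs) = B.ev (map sgen_index ys)"
    using sing_braid_rels_index by blast
  then show ?case using rel clear_pos[OF pos_word_S] by (simp add: pos_word_def)
next
  case (cancel x b)
  note x = sgen_index_S[OF cancel, THEN conjunct1] sgen_index_S[OF cancel, THEN conjunct2]
  have "complement (n-1) (sgen_index x) * E ^ 1 = E ^ 1 * complement (n-1) (sgen_index x)"
    by (rule E_comm[OF letters_complement[OF x]])
  then have "complement (n-1) (sgen_index x) * (E * gen (sgen_index x)) = E * E"
    using gen_complement(2)[OF x] by (simp add: E_def flip: mult.assoc) (simp add: mult.assoc)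
  moreover have "E * gen (sgen_index x) * complement (n-1) (sgen_index x) = E * E"
    using gen_complement(1)[OF x] by (simp add: E_def mult.assoc)
  ultimately show ?case by (cases b) (simp_all add: E_def)
next
  case (transitive u v w)
  \<comment> \<open>The denominator of the middle word is multiplied in and cancelled at the
    end.\<close>
  have "E ^ length v * (E ^ length w * clear (n-1) u) = E ^ length w * (E ^ length v * clear (n-1) u)"
    by (simp only: mult.assoc[symmetric] power_add[symmetric] add.commute)
  also have "\<dots> = E ^ length u * (E ^ length w * clear (n-1) v)"
    unfolding transitive.IH(1) by (simp only: mult.assoc[symmetric] power_add[symmetric] add.commute)
  also have "\<dots> = E ^ length v * (E ^ length u * clear (n-1) w)"
    unfolding transitive.IH(2) by (simp only: mult.assoc[symmetric] power_add[symmetric] add.commute)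
  finally show ?case by (rule left_cancel)
next
  case (compat u u' v v')
  have l: "letters (clear (n-1) u') \<subseteq> {1..n-1}"
    using compat pres_cong_gwords letters_clear by blast
  have "E ^ length (u' @ v') * clear (n-1) (u @ v)
      = E ^ length v' * (E ^ length u' * clear (n-1) u) * clear (n-1) v"
    by (simp add: mult.assoc[symmetric] power_add[symmetric] add.commute)
  also have "\<dots> = E ^ length u * (E ^ length v' * clear (n-1) u') * clear (n-1) v"
    unfolding compat.IH(1) by (simp only: mult.assoc[symmetric] power_add[symmetric] add.commute)
  also have "\<dots> = E ^ length u * clear (n-1) u' * (E ^ length v' * clear (n-1) v)"
    unfolding E_comm[OF l, of "length v'", symmetric] by (simp only: mult.assoc)
  also have "\<dots> = E ^ length u * (clear (n-1) u' * E ^ length v) * clear (n-1) v'"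
    unfolding compat.IH(2) by (simp only: mult.assoc)
  also have "\<dots> = E ^ length (u @ v) * clear (n-1) (u' @ v')"
    unfolding E_comm[OF l] by (simp add: mult.assoc power_add)
  finally show ?case .
qed simp_all

text \<open>The positive braid monoid embeds into SG_n: on positive words \<open>clear\<close> only
  adds a power of E, and left cancellation removes it.\<close>

lemma cls_sw_inj:
  assumes "cls (sw u) = cls (sw v)" "set u \<subseteq> {1..n-1}" "set v \<subseteq> {1..n-1}"
  shows "B.ev u = B.ev v"
proof -
  have uv: "(sw u, sw v) \<in> PC" using assms by (subst cls_eq_iff[symmetric]) auto
  have c: "clear (n-1) (sw w) = E ^ length w * B.ev w" if "set w \<subseteq> {1..n-1}" for w
  proof -
    have "set (map Sig w) \<subseteq> S" using that by auto
    from clear_pos[OF this] show ?thesis by (simp add: comp_def)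
  qed
  have "E ^ length v * (E ^ length u * B.ev u) = E ^ length u * (E ^ length v * B.ev v)"
    using clear_cong[OF uv] c[OF assms(2)] c[OF assms(3)] by (simp add: pos_word_def)
  also have "\<dots> = E ^ length v * (E ^ length u * B.ev v)"
    by (simp only: mult.assoc[symmetric] power_add[symmetric] add.commute)
  finally show ?thesis using left_cancel by blast
qed

lemma centerD: "z \<in> group_center G \<Longrightarrow> g \<in> carrier G \<Longrightarrow> z \<otimes>\<^bsub>G\<^esub> g = g \<otimes>\<^bsub>G\<^esub> z"
  by (simp add: group_center_def)

lemma cls_power_ft: "cls (sw (concat (replicate k ft))) = twist [^]\<^bsub>G\<^esub> k"
proof (induction k)
  case 0
  then show ?case by (simp add: pos_word_def cls_Nil)
next
  case (Suc k)
  have "cls (sw (concat (replicate (Suc k) ft))) = twist \<otimes>\<^bsub>G\<^esub> cls (sw (concat (replicate k ft)))"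
    unfolding twist_def by (simp only: replicate_Suc concat.simps sw_append)
      (rule cls_append, auto simp: set_ft)
  also have "\<dots> = twist [^]\<^bsub>G\<^esub> Suc k"
    unfolding Suc by (rule G.nat_pow_Suc2[OF twist_closed, symmetric])
  finally show ?case .
qed

lemma desing_gwords: "w \<in> gwords S \<Longrightarrow> desing w \<in> gwords S"
  by (induction w) (auto dest: sgen_index_S)

text \<open>Each letter absorbs one full twist: sigma_i stays positive and its inverse becomes
  \<open>complement\<close>. The twists are central and collect on the left.\<close>

lemma clear_denominators:
  "w \<in> gwords S \<Longrightarrow> \<exists>u. set u \<subseteq> {1..n-1} \<and> cls (sw u) = twist [^]\<^bsub>G\<^esub> length w \<otimes>\<^bsub>G\<^esub> cls (desing w)"
proof (induction w)
  case Nil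
  then show ?case by (intro exI[of _ "[]"]) (simp add: pos_word_def cls_Nil)
next
  case (Cons a w)
  obtain x b where a: "a = (x, b)" by fastforce
  define i where "i = sgen_index x"
  have i: "1 \<le> i" "i \<le> n - 1" and w: "w \<in> gwords S" using Cons.prems sgen_index_S by (auto simp: a i_def)
  from Cons obtain u where u: "set u \<subseteq> {1..n-1}" "cls (sw u) = twist [^]\<^bsub>G\<^esub> length w \<otimes>\<^bsub>G\<^esub> cls (desing w)"
    using w by blast
  let ?g = "cls [(Sig i, True)]" and ?d = "cls (desing w)"
  have g: "?g \<in> carrier G" using i by auto
  have d: "?d \<in> carrier G" using desing_gwords[OF w] by blast
  have tk: "twist [^]\<^bsub>G\<^esub> length w \<in> carrier G" by auto
  have swi: "cls (sw [i]) = ?g" by (simp add: pos_word_def)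
  have central: "h \<otimes>\<^bsub>G\<^esub> (twist [^]\<^bsub>G\<^esub> k \<otimes>\<^bsub>G\<^esub> ?d) = twist [^]\<^bsub>G\<^esub> k \<otimes>\<^bsub>G\<^esub> (h \<otimes>\<^bsub>G\<^esub> ?d)"
    if h: "h \<in> carrier G" for h and k :: nat
  proof (induction k)
    case 0
    then show ?case using h d by simp
  next
    case (Suc k)
    let ?t = "twist [^]\<^bsub>G\<^esub> k"
    have t: "?t \<in> carrier G" by auto
    have Sk: "twist [^]\<^bsub>G\<^esub> Suc k = twist \<otimes>\<^bsub>G\<^esub> ?t" by (rule G.nat_pow_Suc2) auto
    have "h \<otimes>\<^bsub>G\<^esub> (twist [^]\<^bsub>G\<^esub> Suc k \<otimes>\<^bsub>G\<^esub> ?d) = (h \<otimes>\<^bsub>G\<^esub> twist) \<otimes>\<^bsub>G\<^esub> (?t \<otimes>\<^bsub>G\<^esub> ?d)"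
      unfolding Sk using h t d by (simp add: G.m_assoc)
    also have "h \<otimes>\<^bsub>G\<^esub> twist = twist \<otimes>\<^bsub>G\<^esub> h" using centerD[OF twist_central h] by simp
    also have "twist \<otimes>\<^bsub>G\<^esub> h \<otimes>\<^bsub>G\<^esub> (?t \<otimes>\<^bsub>G\<^esub> ?d) = twist \<otimes>\<^bsub>G\<^esub> (h \<otimes>\<^bsub>G\<^esub> (?t \<otimes>\<^bsub>G\<^esub> ?d))"
      using h t d by (simp add: G.m_assoc)
    also have "\<dots> = twist [^]\<^bsub>G\<^esub> Suc k \<otimes>\<^bsub>G\<^esub> (h \<otimes>\<^bsub>G\<^esub> ?d)"
      unfolding Suc Sk using h t d by (simp add: G.m_assoc)
    finally show ?case .
  qed
  have "\<exists>v. set v \<subseteq> {1..n-1} \<and> cls (sw v) = twist \<otimes>\<^bsub>G\<^esub> cls [(Sig i, b)]"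
  proof (cases b)
    case True
    have "cls (sw (ft @ [i])) = twist \<otimes>\<^bsub>G\<^esub> ?g"
      unfolding sw_append using i by (subst cls_append) (auto simp: set_ft twist_def swi)
    with True show ?thesis using i by (intro exI[of _ "ft @ [i]"]) (auto simp: set_ft)
  next
    case False
    obtain v where v: "complement (n-1) i = B.ev v" using ev_surj by blast
    have sv: "set v \<subseteq> {1..n-1}" using letters_complement[OF i] v by simp
    have "cls (sw (v @ [i])) = twist"
      unfolding twist_def using gen_complement(2)[OF i] v sv i by (intro braid_eq_cls) auto
    then have "cls (sw v) \<otimes>\<^bsub>G\<^esub> ?g = twist"
      unfolding sw_append using i sv by (subst (asm) cls_append) (auto simp: swi)
    moreover have "cls (sw v) = cls (sw v) \<otimes>\<^bsub>G\<^esub> ?g \<otimes>\<^bsub>G\<^esub> inv\<^bsub>G\<^esub> ?g"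
      using g sv by (simp add: G.m_assoc)
    ultimately have "cls (sw v) = twist \<otimes>\<^bsub>G\<^esub> inv\<^bsub>G\<^esub> ?g" by simp
    with False sv show ?thesis using i by (auto simp: cls_inv)
  qed
  then obtain v where v: "set v \<subseteq> {1..n-1}" "cls (sw v) = twist \<otimes>\<^bsub>G\<^esub> cls [(Sig i, b)]" by blast
  let ?h = "cls [(Sig i, b)]"
  have h: "?h \<in> carrier G" using i by auto
  have "cls (sw (v @ u)) = (twist \<otimes>\<^bsub>G\<^esub> ?h) \<otimes>\<^bsub>G\<^esub> (twist [^]\<^bsub>G\<^esub> length w \<otimes>\<^bsub>G\<^esub> ?d)"
    unfolding sw_append v(2)[symmetric] u(2)[symmetric] using u(1) v(1) by (intro cls_append) auto
  also have "\<dots> = twist \<otimes>\<^bsub>G\<^esub> (twist [^]\<^bsub>G\<^esub> length w \<otimes>\<^bsub>G\<^esub> (?h \<otimes>\<^bsub>G\<^esub> ?d))"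
    using central[OF h] h tk d by (simp add: G.m_assoc)
  also have "?h \<otimes>\<^bsub>G\<^esub> ?d = cls (desing (a # w))"
    using cls_append[of "[(Sig i, b)]" "desing w"] i desing_gwords[OF w] by (simp add: a i_def)
  also have "twist \<otimes>\<^bsub>G\<^esub> (twist [^]\<^bsub>G\<^esub> length w \<otimes>\<^bsub>G\<^esub> cls (desing (a # w)))
      = twist [^]\<^bsub>G\<^esub> length (a # w) \<otimes>\<^bsub>G\<^esub> cls (desing (a # w))"
    using tk desing_gwords[OF Cons.prems] G.nat_pow_Suc2[OF twist_closed, of "length w"]
    by (simp add: G.m_assoc)
  finally show ?case using u(1) v(1) by (intro exI[of _ "v @ u"]) auto
qed

theorem desing_center:
  assumes w: "w \<in> gwords S" and z: "cls (desing w) \<in> group_center G"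
  shows "\<exists>k :: int. cls (desing w) = twist [^]\<^bsub>G\<^esub> k"
proof -
  obtain u where u: "set u \<subseteq> {1..n-1}" "cls (sw u) = twist [^]\<^bsub>G\<^esub> length w \<otimes>\<^bsub>G\<^esub> cls (desing w)"
    using clear_denominators[OF w] by blast
  let ?d = "cls (desing w)"
  have d: "?d \<in> carrier G" using z by (simp add: group_center_def)
  have "gen i * B.ev u = B.ev u * gen i" if i: "1 \<le> i" "i \<le> n - 1" for i
  proof -
    let ?g = "cls (sw [i])"
    have g: "?g \<in> carrier G" using i by (simp add: pos_word_def)
    have pow: "twist [^]\<^bsub>G\<^esub> k \<otimes>\<^bsub>G\<^esub> ?g = ?g \<otimes>\<^bsub>G\<^esub> twist [^]\<^bsub>G\<^esub> k" for k :: nat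
      using centerD[OF twist_central g] g by (intro G.group_commutes_pow) auto
    have "cls (sw ([i] @ u)) = ?g \<otimes>\<^bsub>G\<^esub> cls (sw u)"
      unfolding sw_append using i u(1) by (intro cls_append) auto
    also have "\<dots> = (?g \<otimes>\<^bsub>G\<^esub> twist [^]\<^bsub>G\<^esub> length w) \<otimes>\<^bsub>G\<^esub> ?d"
      unfolding u(2) using g d by (simp add: G.m_assoc)
    also have "\<dots> = twist [^]\<^bsub>G\<^esub> length w \<otimes>\<^bsub>G\<^esub> (?g \<otimes>\<^bsub>G\<^esub> ?d)"
      unfolding pow[symmetric] using g d by (simp add: G.m_assoc)
    also have "?g \<otimes>\<^bsub>G\<^esub> ?d = ?d \<otimes>\<^bsub>G\<^esub> ?g" using centerD[OF z g] by simp
    also have "twist [^]\<^bsub>G\<^esub> length w \<otimes>\<^bsub>G\<^esub> (?d \<otimes>\<^bsub>G\<^esub> ?g) = cls (sw u) \<otimes>\<^bsub>G\<^esub> ?g"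
      unfolding u(2) using g d by (simp add: G.m_assoc)
    also have "\<dots> = cls (sw (u @ [i]))"
      unfolding sw_append using i u(1) by (intro cls_append[symmetric]) auto
    \<comment> \<open>Injectivity on positive words carries the commutation over from the group to
      the monoid.\<close>
    finally have "B.ev ([i] @ u) = B.ev (u @ [i])"
      using i u(1) by (intro cls_sw_inj) auto
    then show ?thesis by simp
  qed
  moreover have two: "2 \<le> n - 1" using n by simp
  ultimately obtain k where k: "B.ev u = B.ev ft ^ k"
    using braid_monoid_center[of "n - 1" "B.ev u"] two u(1) by auto
  have "B.ev (concat (replicate k ft)) = B.ev ft ^ k" by (induction k) auto
  then have "cls (sw u) = twist [^]\<^bsub>G\<^esub> k"
    using k u(1) cls_power_ft[of k] by (metis braid_eq_cls)
  then have e: "twist [^]\<^bsub>G\<^esub> length w \<otimes>\<^bsub>G\<^esub> ?d = twist [^]\<^bsub>G\<^esub> k" using u(2) by simp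
  have "?d = inv\<^bsub>G\<^esub> (twist [^]\<^bsub>G\<^esub> length w) \<otimes>\<^bsub>G\<^esub> twist [^]\<^bsub>G\<^esub> k"
    using d by (intro G.inv_solve_left[THEN iffD2]) (auto simp: e)
  also have "\<dots> = twist [^]\<^bsub>G\<^esub> (- int (length w) + int k)"
    by (simp only: G.int_pow_mult[OF twist_closed] G.int_pow_neg_int[OF twist_closed] int_pow_int)
  finally show ?thesis by blast
qed

end

section \<open>Groups of bijections\<close>

definition bij_group :: "('a \<Rightarrow> 'a) monoid" where
  "bij_group = \<lparr>carrier = {f. bij f}, mult = (\<circ>), one = id\<rparr>"

lemma bij_group_simps [simp]:
  "carrier bij_group = {f. bij f}" "f \<otimes>\<^bsub>bij_group\<^esub> g = f \<circ> g" "\<one>\<^bsub>bij_group\<^esub> = id"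
  by (simp_all add: bij_group_def)

lemma group_bij_group: "group bij_group"
proof (rule groupI)
  fix f :: "'a \<Rightarrow> 'a" assume "f \<in> carrier bij_group"
  then show "\<exists>g\<in>carrier bij_group. g \<otimes>\<^bsub>bij_group\<^esub> f = \<one>\<^bsub>bij_group\<^esub>"
    by (intro bexI[of _ "inv_into UNIV f"]) (simp_all add: bij_imp_bij_inv bij_is_inj)
qed (auto intro: bij_comp)

lemma word_eval_bij_pos:
  "word_eval bij_group f (pos_word xs) = foldr (\<lambda>x. (\<circ>) (f x)) xs id"
  by (induction xs) (auto simp: word_eval_def pos_word_def)


section \<open>The Burau representation at \<open>-1\<close>\<close>

text \<open>The transvection along the i-th basis vector for the alternating form in which
  neighbouring basis vectors pair to 1 or -1. Coordinate 0 is a boundary value that is never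
  changed, as i >= 1 for all generators.\<close>

definition transvection :: "nat \<Rightarrow> (nat \<Rightarrow> int) \<Rightarrow> nat \<Rightarrow> int" where
  "transvection i a = a(i := a i + a (i - 1) - a (Suc i))"

text \<open>With tau_i trivial, the mixed relations have equal sides, and t_i acts as the inverse
  transvection.\<close>

fun burau :: "sgen \<Rightarrow> (nat \<Rightarrow> int) \<Rightarrow> nat \<Rightarrow> int" where
  "burau (Sig i) = transvection i"
| "burau (Tau i) = id"

lemma bij_transvection: "1 \<le> i \<Longrightarrow> bij (transvection i)"
  by (rule o_bij[where g = "\<lambda>a. a(i := a i - a (i - 1) + a (Suc i))"])
    (auto simp: transvection_def fun_eq_iff)

lemma transvection_braid:
  "1 \<le> i \<Longrightarrow> transvection i \<circ> (transvection (Suc i) \<circ> transvection i)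
    = transvection (Suc i) \<circ> (transvection i \<circ> transvection (Suc i))"
  by (cases i) (auto simp: transvection_def fun_eq_iff)

lemma transvection_far:
  "1 \<le> i \<Longrightarrow> 1 \<le> j \<Longrightarrow> \<bar>int i - int j\<bar> \<ge> 2 \<Longrightarrow> transvection i \<circ> transvection j = transvection j \<circ> transvection i"
  by (cases i; cases j) (auto simp: transvection_def fun_eq_iff)

lemma transvection_power: "1 \<le> j \<Longrightarrow> (transvection j ^^ k) a = a(j := a j + int k * (a (j - 1) - a (Suc j)))"
  by (induction k) (auto simp: transvection_def fun_eq_iff algebra_simps)

lemma pres_hom_burau: "pres_hom bij_group (sing_braid_gens n) (sing_braid_rels n) burau"
proof -
  interpret group bij_group by (rule group_bij_group)
  show ?thesis
  proof
    show "burau \<in> sing_braid_gens n \<rightarrow> carrier bij_group"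
      by (auto simp: sing_braid_gens_def bij_transvection)
    show "word_eval bij_group burau u = word_eval bij_group burau v"
      if "(u, v) \<in> sing_braid_rels n" for u v
      using that unfolding sing_braid_rels_def
      by (elim imageE UnE) (auto simp: word_eval_bij_pos transvection_braid transvection_far)
  qed
qed


section \<open>Support in right-angled Artin groups\<close>

text \<open>Deleting letters turns a commutation relation into itself or, if one of its letters
  disappears, into a trivial equality.\<close>

lemma pres_cong_filter:
  assumes R: "\<And>u v. (u, v) \<in> R \<Longrightarrow> \<exists>x y. u = [x, y] \<and> v = [y, x]"
  shows "(u, v) \<in> pres_cong V R \<Longrightarrow> (filter (\<lambda>p. fst p \<in> T) u, filter (\<lambda>p. fst p \<in> T) v) \<in> pres_cong V R"
proof (induction rule: pres_cong.induct)
  case (rel u v)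
  then obtain x y where uv: "u = [x, y]" "v = [y, x]" using R by blast
  show ?case
  proof (cases "fst x \<in> T \<and> fst y \<in> T")
    case True
    then show ?thesis using rel uv pres_cong.rel[of u v R V] by simp
  next
    case False
    then show ?thesis using rel uv by (auto intro: pres_cong.reflexive)
  qed
next
  case (cancel x b)
  then show ?case using pres_cong.cancel[of x V b R] by (auto intro: pres_cong.reflexive)
next
  case (reflexive u)
  then have "filter P u \<in> gwords V" for P by (auto simp: gwords_def)
  then show ?case by (rule pres_cong.reflexive)
qed (auto intro: pres_cong.symmetric pres_cong.transitive pres_cong.compat)

lemma pres_cong_map:
  assumes V: "\<And>x. x \<in> V \<Longrightarrow> f x \<in> V"
    and R: "\<And>u v. (u, v) \<in> R \<Longrightarrow> u \<in> gwords V \<Longrightarrow> v \<in> gwords V \<Longrightarrow> (map (apfst f) u, map (apfst f) v) \<in> R"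
  shows "(u, v) \<in> pres_cong V R \<Longrightarrow> (map (apfst f) u, map (apfst f) v) \<in> pres_cong V R"
proof -
  have gw: "w \<in> gwords V \<Longrightarrow> map (apfst f) w \<in> gwords V" for w
    by (induction w) (auto simp: V)
  show "(u, v) \<in> pres_cong V R \<Longrightarrow> ?thesis"
  proof (induction rule: pres_cong.induct)
    case (cancel x b)
    then show ?case using pres_cong.cancel[of "f x" V b R] V by simp
  qed (auto intro: pres_cong.rel pres_cong.symmetric pres_cong.transitive pres_cong.compat pres_cong.reflexive simp: R gw)
qed

text \<open>If two finite sets \<open>T\<close>, \<open>T'\<close> of generators support an element, then so does \<open>T \<inter> T'\<close>
  because of the retraction killing the generators outside \<open>T'\<close>. Hence a support of minimal
  cardinality is mapped to itself by every automorphism that permutes the generators and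
  fixes the element.\<close>

lemma invariant_support:
  assumes R: "\<And>u v. (u, v) \<in> R \<Longrightarrow> \<exists>x y. u = [x, y] \<and> v = [y, x]"
    and V: "\<And>f x. f \<in> F \<Longrightarrow> x \<in> V \<Longrightarrow> f x \<in> V"
    and rels: "\<And>f u v. f \<in> F \<Longrightarrow> (u, v) \<in> R \<Longrightarrow> u \<in> gwords V \<Longrightarrow> v \<in> gwords V
      \<Longrightarrow> (map (apfst f) u, map (apfst f) v) \<in> R"
    and a: "a \<in> gwords V" and fixed: "\<And>f. f \<in> F \<Longrightarrow> (a, map (apfst f) a) \<in> pres_cong V R"
  obtains T u where "finite T" "T \<subseteq> V" "u \<in> gwords T" "(a, u) \<in> pres_cong V R" "\<And>f. f \<in> F \<Longrightarrow> f ` T = T"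
proof -
  define supp where "supp T \<longleftrightarrow> finite T \<and> T \<subseteq> V \<and> (\<exists>u\<in>gwords T. (a, u) \<in> pres_cong V R)" for T
  have mono: "u \<in> gwords B" if "u \<in> gwords A" "A \<subseteq> B" for u :: "'a gword" and A B
    using that by (induction u) auto
  have "a \<in> gwords (fst ` set a)" by (auto simp: gwords_def intro: rev_image_eqI)
  moreover have "fst ` set a \<subseteq> V" using a by (auto simp: gwords_def)
  ultimately have "supp (fst ` set a)"
    unfolding supp_def using a by (auto intro: pres_cong.reflexive)
  then obtain T where T: "supp T" and least: "\<And>T'. supp T' \<Longrightarrow> card T \<le> card T'"
    using ex_has_least_nat[of supp "fst ` set a" card] by blast
  obtain u where u: "finite T" "T \<subseteq> V" "u \<in> gwords T" "(a, u) \<in> pres_cong V R"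
    using T by (auto simp: supp_def)
  have "f ` T = T" if f: "f \<in> F" for f
  proof -
    let ?u = "map (apfst f) u"
    have au: "(a, ?u) \<in> pres_cong V R"
      using fixed[OF f] pres_cong_map[OF V[OF f] rels[OF f] u(4)] by (blast intro: pres_cong.transitive)
    have "map (apfst f) w \<in> gwords (f ` T)" if "w \<in> gwords T" for w
      using that by (induction w) auto
    then have gu: "?u \<in> gwords (f ` T)" using u(3) by blast
    have "filter (\<lambda>p. fst p \<in> A) w = w" if "w \<in> gwords A" for w :: "'a gword" and A
      using that by (induction w) auto
    then have id: "filter (\<lambda>p. fst p \<in> f ` T) ?u = ?u" using gu by blast
    have "(u, ?u) \<in> pres_cong V R"
      using u(4) au by (blast intro: pres_cong.symmetric pres_cong.transitive)
    from pres_cong_filter[OF R this, of "f ` T"]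
    have "(filter (\<lambda>p. fst p \<in> f ` T) u, ?u) \<in> pres_cong V R"
      unfolding id by blast
    then have "(a, filter (\<lambda>p. fst p \<in> f ` T) u) \<in> pres_cong V R"
      using au by (blast intro: pres_cong.symmetric pres_cong.transitive)
    moreover have "filter (\<lambda>p. fst p \<in> f ` T) u \<in> gwords (T \<inter> f ` T)"
      using u(3) by (auto simp: gwords_def)
    ultimately have "supp (T \<inter> f ` T)" using u(1,2) by (auto simp: supp_def)
    from least[OF this] have "T \<inter> f ` T = T"
      using u(1) by (metis card_seteq inf_le1)
    then have "T \<subseteq> f ` T" by blast
    moreover have "card (f ` T) \<le> card T" using u(1) by (rule card_image_le)
    ultimately show ?thesis using u(1) by (metis card_seteq finite_imageI)
  qed
  with u show thesis by (rule that)
qed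

section \<open>The action on a right-angled Artin group\<close>

context group begin

definition conj_by :: "'a \<Rightarrow> 'a \<Rightarrow> 'a" where
  "conj_by g x = g \<otimes> x \<otimes> inv g"

lemma conj_by_closed [simp, intro]: "g \<in> carrier G \<Longrightarrow> x \<in> carrier G \<Longrightarrow> conj_by g x \<in> carrier G"
  by (simp add: conj_by_def)

lemma conj_by_one [simp]: "x \<in> carrier G \<Longrightarrow> conj_by \<one> x = x" "g \<in> carrier G \<Longrightarrow> conj_by g \<one> = \<one>"
  by (simp_all add: conj_by_def)

lemma conj_by_eqI: "g \<in> carrier G \<Longrightarrow> x \<in> carrier G \<Longrightarrow> y \<in> carrier G \<Longrightarrow> g \<otimes> x = y \<otimes> g \<Longrightarrow> conj_by g x = y"
  by (simp add: conj_by_def m_assoc)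

lemma conj_by_conj_by:
  "g \<in> carrier G \<Longrightarrow> h \<in> carrier G \<Longrightarrow> x \<in> carrier G \<Longrightarrow> conj_by g (conj_by h x) = conj_by (g \<otimes> h) x"
  by (simp add: conj_by_def inv_mult_group m_assoc)

lemma conj_by_swap: "g \<in> carrier G \<Longrightarrow> x \<in> carrier G \<Longrightarrow> conj_by g x \<otimes> g = g \<otimes> x"
  by (simp add: conj_by_def m_assoc)

lemma conj_by_swap_assoc:
  "g \<in> carrier G \<Longrightarrow> x \<in> carrier G \<Longrightarrow> y \<in> carrier G \<Longrightarrow> conj_by g x \<otimes> (g \<otimes> y) = g \<otimes> (x \<otimes> y)"
  by (simp add: conj_by_swap flip: m_assoc)

lemma conj_by_mult:
  assumes "g \<in> carrier G" "x \<in> carrier G" "y \<in> carrier G"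
  shows "conj_by g (x \<otimes> y) = conj_by g x \<otimes> conj_by g y"
proof (rule conj_by_eqI)
  show "g \<otimes> (x \<otimes> y) = conj_by g x \<otimes> conj_by g y \<otimes> g"
    using assms by (simp add: m_assoc conj_by_swap conj_by_swap_assoc)
qed (use assms in auto)

lemma conj_by_inv:
  assumes "g \<in> carrier G" "x \<in> carrier G"
  shows "conj_by g (inv x) = inv (conj_by g x)"
  using conj_by_mult[OF assms(1), of "inv x" x] assms by (intro inv_equality[symmetric]) auto

lemma conj_by_cancel:
  "g \<in> carrier G \<Longrightarrow> x \<in> carrier G \<Longrightarrow> conj_by g (conj_by (inv g) x) = x"
  "g \<in> carrier G \<Longrightarrow> x \<in> carrier G \<Longrightarrow> conj_by (inv g) (conj_by g x) = x"
  by (simp_all add: conj_by_conj_by)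

lemma conj_by_fix_commute:
  "g \<in> carrier G \<Longrightarrow> x \<in> carrier G \<Longrightarrow> conj_by g x = x \<Longrightarrow> g \<otimes> x = x \<otimes> g"
  using conj_by_swap[of g x] by simp

text \<open>Used to conjugate t_i = tau_i sigma_i^-1 by treating tau_i and sigma_i
  separately.\<close>

lemma conj_by_div_eqI:
  assumes "g \<in> carrier G" "x \<in> carrier G" "x' \<in> carrier G" "y \<in> carrier G" "y' \<in> carrier G"
    and "g \<otimes> x = x' \<otimes> g" "g \<otimes> y = y' \<otimes> g"
  shows "conj_by g (x \<otimes> inv y) = x' \<otimes> inv y'"
  using assms conj_by_eqI[of g x x'] conj_by_eqI[of g y y'] by (simp add: conj_by_mult conj_by_inv)

end

context sing_braid begin

abbreviation "cj \<equiv> G.conj_by"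

definition s :: "nat \<Rightarrow> sgen gword set" where "s i = cls [(Sig i, True)]"
definition tau :: "nat \<Rightarrow> sgen gword set" where "tau i = cls [(Tau i, True)]"
definition t :: "nat \<Rightarrow> sgen gword set" where "t i = tau i \<otimes>\<^bsub>G\<^esub> inv\<^bsub>G\<^esub> s i"

abbreviation I :: "nat set" where "I \<equiv> {1..n-1}"

lemma st_closed [simp]: "i \<in> I \<Longrightarrow> s i \<in> carrier G" "i \<in> I \<Longrightarrow> tau i \<in> carrier G" "i \<in> I \<Longrightarrow> t i \<in> carrier G"
  by (auto simp: s_def tau_def t_def)

lemma tau_eq: "i \<in> I \<Longrightarrow> tau i = t i \<otimes>\<^bsub>G\<^esub> s i"
  using st_closed[of i] by (simp add: t_def G.m_assoc)

lemma rel_cls: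
  assumes "(l, r) \<in> sing_rels" "set l \<subseteq> S"
  shows "cls (pos_word l) = cls (pos_word r)"
  using rel_sing[OF assms] by (rule cls_eqI)

lemma cls_pos_Cons: "x \<in> S \<Longrightarrow> set xs \<subseteq> S \<Longrightarrow> cls (pos_word (x # xs)) = cls [(x, True)] \<otimes>\<^bsub>G\<^esub> cls (pos_word xs)"
proof -
  assume x: "x \<in> S" and xs: "set xs \<subseteq> S"
  have "pos_word xs \<in> gwords S" using xs by (induction xs) (auto simp: pos_word_def)
  then show ?thesis using x cls_append[of "[(x, True)]" "pos_word xs"] by (simp add: pos_word_def)
qed

lemma tau_s_far: "i \<in> I \<Longrightarrow> j \<in> I \<Longrightarrow> Suc i < j \<or> Suc j < i \<Longrightarrow> tau i \<otimes>\<^bsub>G\<^esub> s j = s j \<otimes>\<^bsub>G\<^esub> tau i"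
  using rel_cls[of "[Tau i, Sig j]" "[Sig j, Tau i]"]
  by (simp add: sing_rels_def cls_pos_Cons s_def tau_def)

lemma s_s_far: "i \<in> I \<Longrightarrow> j \<in> I \<Longrightarrow> Suc i < j \<or> Suc j < i \<Longrightarrow> s i \<otimes>\<^bsub>G\<^esub> s j = s j \<otimes>\<^bsub>G\<^esub> s i"
  using rel_cls[of "[Sig i, Sig j]" "[Sig j, Sig i]"] rel_cls[of "[Sig j, Sig i]" "[Sig i, Sig j]"]
  by (auto simp: sing_rels_def cls_pos_Cons s_def)

lemma tau_tau_far: "i \<in> I \<Longrightarrow> j \<in> I \<Longrightarrow> \<bar>int i - int j\<bar> \<ge> 2 \<Longrightarrow> tau i \<otimes>\<^bsub>G\<^esub> tau j = tau j \<otimes>\<^bsub>G\<^esub> tau i"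
proof -
  assume ij: "i \<in> I" "j \<in> I" "\<bar>int i - int j\<bar> \<ge> 2"
  have "(pos_word [Tau i, Tau j], pos_word [Tau j, Tau i]) \<in> R"
    unfolding sing_braid_rels_def by (rule pos_pair) (use ij in auto)
  then have "cls (pos_word [Tau i, Tau j]) = cls (pos_word [Tau j, Tau i])"
    using ij by (intro cls_eqI pres_cong.rel) (auto simp: pos_word_def)
  then show ?thesis using ij by (simp add: cls_pos_Cons tau_def)
qed

lemma tau_s_same: "i \<in> I \<Longrightarrow> tau i \<otimes>\<^bsub>G\<^esub> s i = s i \<otimes>\<^bsub>G\<^esub> tau i"
  using rel_cls[of "[Tau i, Sig i]" "[Sig i, Tau i]"]
  by (simp add: sing_rels_def cls_pos_Cons s_def tau_def)

lemma cj_s_same: "i \<in> I \<Longrightarrow> cj (s i) (t i) = t i"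
  unfolding t_def by (rule G.conj_by_div_eqI) (simp_all add: tau_s_same)

lemma cj_s_far: "i \<in> I \<Longrightarrow> j \<in> I \<Longrightarrow> Suc i < j \<or> Suc j < i \<Longrightarrow> cj (s j) (t i) = t i"
  unfolding t_def by (rule G.conj_by_div_eqI) (use tau_s_far[of i j] s_s_far[of i j] in simp_all)

lemma t_t_far:
  assumes ij: "i \<in> I" "j \<in> I" "\<bar>int i - int j\<bar> \<ge> 2"
  shows "t i \<otimes>\<^bsub>G\<^esub> t j = t j \<otimes>\<^bsub>G\<^esub> t i"
proof (rule G.conj_by_fix_commute)
  have far: "Suc i < j \<or> Suc j < i" using ij by auto
  have 1: "t i \<otimes>\<^bsub>G\<^esub> s j = s j \<otimes>\<^bsub>G\<^esub> t i"
    using cj_s_far[OF ij(1,2) far] ij by (intro G.conj_by_fix_commute[symmetric]) simp_all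
  have "tau j \<otimes>\<^bsub>G\<^esub> s i = s i \<otimes>\<^bsub>G\<^esub> tau j" using ij far by (intro tau_s_far) auto
  then have "cj (tau j) (t i) = t i"
    unfolding t_def using tau_tau_far[OF ij] ij by (intro G.conj_by_div_eqI) simp_all
  then have "t i \<otimes>\<^bsub>G\<^esub> tau j = tau j \<otimes>\<^bsub>G\<^esub> t i"
    using ij by (intro G.conj_by_fix_commute[symmetric]) simp_all
  with 1 show "cj (t i) (t j) = t j"
    unfolding t_def[of j] using ij by (intro G.conj_by_div_eqI) simp_all
qed (use ij in simp_all)

text \<open>Conjugation by sigma_i sigma_(i+1) shifts the index i of sigma by the braid relation and
  that of tau by the mixed relation, hence also that of their quotient.\<close>

lemma cj_up:
  assumes "i \<in> I" "Suc i \<in> I"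
  shows "cj (s i) (cj (s (Suc i)) (t i)) = t (Suc i)"
proof -
  let ?g = "s i \<otimes>\<^bsub>G\<^esub> s (Suc i)"
  have "?g \<otimes>\<^bsub>G\<^esub> s i = s (Suc i) \<otimes>\<^bsub>G\<^esub> ?g" "?g \<otimes>\<^bsub>G\<^esub> tau i = tau (Suc i) \<otimes>\<^bsub>G\<^esub> ?g"
    using rel_cls[of "[Sig i, Sig (Suc i), Sig i]" "[Sig (Suc i), Sig i, Sig (Suc i)]"]
      rel_cls[of "[Sig i, Sig (Suc i), Tau i]" "[Tau (Suc i), Sig i, Sig (Suc i)]"] assms
    by (simp_all add: sing_rels_def cls_pos_Cons s_def tau_def G.m_assoc)
  then have "cj ?g (t i) = t (Suc i)"
    unfolding t_def using assms by (intro G.conj_by_div_eqI) simp_all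
  then show ?thesis using assms by (simp add: G.conj_by_conj_by)
qed

lemma cj_down:
  assumes "i \<in> I" "Suc i \<in> I"
  shows "cj (s (Suc i)) (cj (s i) (t (Suc i))) = t i"
proof -
  let ?g = "s (Suc i) \<otimes>\<^bsub>G\<^esub> s i"
  have "?g \<otimes>\<^bsub>G\<^esub> s (Suc i) = s i \<otimes>\<^bsub>G\<^esub> ?g" "?g \<otimes>\<^bsub>G\<^esub> tau (Suc i) = tau i \<otimes>\<^bsub>G\<^esub> ?g"
    using rel_cls[of "[Sig i, Sig (Suc i), Sig i]" "[Sig (Suc i), Sig i, Sig (Suc i)]"]
      rel_cls[of "[Sig (Suc i), Sig i, Tau (Suc i)]" "[Tau i, Sig (Suc i), Sig i]"] assms
    by (simp_all add: sing_rels_def cls_pos_Cons s_def tau_def G.m_assoc)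
  then have "cj ?g (t (Suc i)) = t i"
    unfolding t_def using assms by (intro G.conj_by_div_eqI) simp_all
  then show ?thesis using assms by (simp add: G.conj_by_conj_by)
qed

definition sg :: "nat \<Rightarrow> bool \<Rightarrow> sgen gword set" where "sg i b = cls [(Sig i, b)]"

lemma sg_simps: "sg i True = s i" "i \<in> I \<Longrightarrow> sg i False = inv\<^bsub>G\<^esub> s i"
  by (auto simp: sg_def s_def cls_inv)

lemma sg_closed [simp]: "i \<in> I \<Longrightarrow> sg i b \<in> carrier G"
  by (auto simp: sg_def)

lemma cj_sg_cancel: "i \<in> I \<Longrightarrow> x \<in> carrier G \<Longrightarrow> cj (sg i b) (cj (sg i (\<not> b)) x) = x"
  by (cases b) (auto simp: sg_simps G.conj_by_cancel)

lemma cj_sg_same: "i \<in> I \<Longrightarrow> cj (sg i b) (t i) = t i"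
  using cj_sg_cancel[of i "t i" b] by (cases b) (auto simp: sg_simps cj_s_same)

text \<open>The conjugates are elements of the group, so coincidences and commutation among them are
  decided there, and evaluating words over \<open>V\<close> in the group respects \<open>RV\<close>
  by definition.\<close>

inductive_set V where
  t: "i \<in> I \<Longrightarrow> t i \<in> V"
| cj: "x \<in> V \<Longrightarrow> i \<in> I \<Longrightarrow> cj (sg i b) x \<in> V"

lemma V_closed: "x \<in> V \<Longrightarrow> x \<in> carrier G"
  by (induction rule: V.induct) auto

definition RV :: "(sgen gword set gword \<times> sgen gword set gword) set" where
  "RV = {([(x, True), (y, True)], [(y, True), (x, True)]) | x y. x \<in> V \<and> y \<in> V \<and> x \<otimes>\<^bsub>G\<^esub> y = y \<otimes>\<^bsub>G\<^esub> x}"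

abbreviation "VC \<equiv> pres_cong V RV"
abbreviation "cjw g \<equiv> map (apfst (cj g))"

lemma cjw_gwords: "a \<in> gwords V \<Longrightarrow> i \<in> I \<Longrightarrow> cjw (sg i b) a \<in> gwords V"
  by (induction a) (auto intro: V.cj)

lemma cjw_RV: "i \<in> I \<Longrightarrow> (u, v) \<in> RV \<Longrightarrow> (cjw (sg i b) u, cjw (sg i b) v) \<in> RV"
  using V_closed by (auto simp: RV_def G.conj_by_mult[symmetric] intro!: V.cj)

lemma cjw_VC: "i \<in> I \<Longrightarrow> (u, v) \<in> VC \<Longrightarrow> (cjw (sg i b) u, cjw (sg i b) v) \<in> VC"
  by (rule pres_cong_map) (auto intro: V.cj cjw_RV)

lemma cjw_cjw: "a \<in> gwords V \<Longrightarrow> g \<in> carrier G \<Longrightarrow> h \<in> carrier G \<Longrightarrow> cjw g (cjw h a) = cjw (g \<otimes>\<^bsub>G\<^esub> h) a"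
  by (induction a) (auto simp: V_closed G.conj_by_conj_by apfst_def map_prod_def split: prod.splits)

lemma cjw_one: "a \<in> gwords V \<Longrightarrow> cjw \<one>\<^bsub>G\<^esub> a = a"
  by (induction a) (auto simp: V_closed)

text \<open>As t_i commutes with sigma_i, the inverse of tau_i is t_i^-1 sigma_i^-1; hence both
  exponents put the vertex on the left of the conjugation.\<close>

fun sing_part :: "sgen \<Rightarrow> bool \<Rightarrow> sgen gword set gword" where
  "sing_part (Sig i) b = []"
| "sing_part (Tau i) b = [(t i, b)]"

text \<open>The action of \<open>SG\<^sub>n\<close> on the right-angled Artin group with vertex set \<open>V\<close>:
  \<open>\<sigma>\<^sub>i\<close> permutes the vertices by conjugation, and \<open>t\<^sub>i = \<tau>\<^sub>i \<sigma>\<^sub>i\<^sup>-\<^sup>1\<close> multiplies by the vertex \<open>t\<^sub>i\<close>.\<close>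

definition act :: "sgen gword \<Rightarrow> sgen gword set gword \<Rightarrow> sgen gword set gword" where
  "act w a = foldr (\<lambda>(x, b) a. sing_part x b @ cjw (sg (sgen_index x) b) a) w a"

lemma act_simps [simp]: "act [] a = a"
  "act ((x, b) # w) a = sing_part x b @ cjw (sg (sgen_index x) b) (act w a)"
  "act (u @ v) a = act u (act v a)"
  by (simp_all add: act_def)

lemma sgen_index_bounds [simp]:
  "x \<in> S \<Longrightarrow> Suc 0 \<le> sgen_index x" "x \<in> S \<Longrightarrow> sgen_index x \<le> n - Suc 0"
  using sgen_index_S by auto

lemma sgen_index_I: "x \<in> S \<Longrightarrow> sgen_index x \<in> I"
  using sgen_index_S by auto

lemma sing_part_gwords: "x \<in> S \<Longrightarrow> sing_part x b \<in> gwords V"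
  by (cases x) (auto intro: V.t)

lemma act_gwords: "w \<in> gwords S \<Longrightarrow> a \<in> gwords V \<Longrightarrow> act w a \<in> gwords V"
  by (induction w) (auto simp: sing_part_gwords cjw_gwords sgen_index_I)

lemma act_VC: "w \<in> gwords S \<Longrightarrow> (a, a') \<in> VC \<Longrightarrow> (act w a, act w a') \<in> VC"
proof (induction w)
  case (Cons p w)
  obtain x b where p: "p = (x, b)" by fastforce
  with Cons show ?case
    by (auto intro!: pres_cong.compat pres_cong.reflexive sing_part_gwords cjw_VC sgen_index_I)
qed simp

text \<open>The action is affine: its linear part is conjugation by the underlying braid, its
  translation part is the orbit point of the empty word.\<close>

lemma act_append: "w \<in> gwords S \<Longrightarrow> a \<in> gwords V \<Longrightarrow> act w a = act w [] @ cjw (cls (desing w)) a"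
proof (induction w)
  case Nil
  then show ?case by (simp add: cls_Nil cjw_one)
next
  case (Cons p w)
  obtain x b where p: "p = (x, b)" by fastforce
  have x: "sgen_index x \<in> I" and w: "w \<in> gwords S" using Cons.prems p by (auto simp: sgen_index_I)
  have "cls (desing (p # w)) = sg (sgen_index x) b \<otimes>\<^bsub>G\<^esub> cls (desing w)"
    using cls_append[of "[(Sig (sgen_index x), b)]" "desing w"] x desing_gwords[OF w] by (simp add: p sg_def)
  then show ?case
    using Cons x w desing_gwords[OF w] by (simp add: p cjw_cjw[symmetric])
qed

text \<open>Words with the same underlying braid have the same linear part, so a relation needs to
  be checked on the empty word only.\<close>

lemma VC_pos:
  assumes "(act (pos_word xs) [], act (pos_word ys) []) \<in> VC" "set xs \<subseteq> S" "set ys \<subseteq> S"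
    "B.ev (map sgen_index xs) = B.ev (map sgen_index ys)" "a \<in> gwords V"
  shows "(act (pos_word xs) a, act (pos_word ys) a) \<in> VC"
proof -
  have gw: "pos_word zs \<in> gwords S" if "set zs \<subseteq> S" for zs
    using that by (induction zs) (auto simp: pos_word_def)
  have d: "desing (pos_word zs) = sw (map sgen_index zs)" for zs
    by (induction zs) (auto simp: pos_word_def)
  have "cls (desing (pos_word xs)) = cls (desing (pos_word ys))"
    unfolding d using assms(2,4) sgen_index_I by (intro braid_eq_cls) auto
  moreover have "cjw (cls (desing (pos_word ys))) a \<in> gwords V"
  proof -
    have zs: "cjw (cls (sw zs)) a \<in> gwords V" if "set zs \<subseteq> I" for zs
      using that
    proof (induction zs)
      case Nil
      then show ?case using assms(5) by (simp add: pos_word_def cls_Nil cjw_one)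
    next
      case (Cons i zs)
      have "set (map Sig zs) \<subseteq> S" using Cons.prems by auto
      then have "cls (sw (i # zs)) = sg i True \<otimes>\<^bsub>G\<^esub> cls (sw zs)"
        using cls_pos_Cons[of "Sig i" "map Sig zs"] Cons.prems by (simp add: sg_def)
      moreover have "cls (sw zs) \<in> carrier G" using Cons.prems by (intro cls_closed) auto
      ultimately have "cjw (cls (sw (i # zs))) a = cjw (sg i True) (cjw (cls (sw zs)) a)"
        using Cons.prems assms(5) by (simp only: cjw_cjw sg_closed list.set insert_subset)
      then show ?case using Cons by (simp only: cjw_gwords list.set insert_subset)
    qed
    show ?thesis unfolding d by (rule zs) (use assms(3) in auto)
  qed
  ultimately show ?thesis
    unfolding act_append[OF gw[OF assms(2)] assms(5)] act_append[OF gw[OF assms(3)] assms(5)]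
    by (simp only: pres_cong.compat[OF assms(1) pres_cong.reflexive])
qed

text \<open>Only the relation between two distant tau's uses a commutation of vertices. For every
  other relation the two sides produce the same word, by \<open>cj_up\<close>,
  \<open>cj_down\<close> and the vertices fixed by sigma_j.\<close>

lemma act_rel:
  assumes "(u, v) \<in> R"
  shows "(act u [], act v []) \<in> VC"
proof -
  have tt: "([(t i, True), (t j, True)], [(t j, True), (t i, True)]) \<in> VC"
    if "i \<in> I" "j \<in> I" "\<bar>int i - int j\<bar> \<ge> 2" for i j
    using t_t_far[OF that] that by (intro pres_cong.rel) (auto simp: RV_def intro: V.t)
  have far: "cj (s j) (t i) = t i" if "i \<in> I" "j \<in> I" "\<bar>int i - int j\<bar> \<ge> 2" for i j
    using that by (intro cj_s_far) auto
  have "i \<le> n - Suc 0" "Suc i \<le> n - Suc 0" if "i \<le> n - 2" for i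
    using that n by auto
  then show ?thesis
    using assms unfolding sing_braid_rels_def
    by (elim imageE UnE)
      (auto simp: pos_word_def sg_simps far cj_s_same cj_up cj_down abs_minus_commute
        intro!: tt V.t pres_cong.reflexive)
qed

lemma act_cong: "(u, v) \<in> PC \<Longrightarrow> a \<in> gwords V \<Longrightarrow> (act u a, act v a) \<in> VC"
proof (induction arbitrary: a rule: pres_cong.induct)
  case (rel u v)
  then obtain xs ys where xy: "u = pos_word xs" "v = pos_word ys"
    "B.ev (map sgen_index xs) = B.ev (map sgen_index ys)"
    using sing_braid_rels_index by blast
  show ?case unfolding xy(1,2)
  proof (rule VC_pos[OF _ _ _ xy(3) rel.prems])
    show "(act (pos_word xs) [], act (pos_word ys) []) \<in> VC"
      using act_rel[OF rel(1)] by (simp only: xy(1,2))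
    show "set xs \<subseteq> S" "set ys \<subseteq> S"
      using rel(2,3) pos_word_S unfolding xy(1,2) by blast+
  qed
next
  case (cancel x b)
  have i: "sgen_index x \<in> I" by (rule sgen_index_I[OF cancel(1)])
  have c: "cjw (sg (sgen_index x) b) (cjw (sg (sgen_index x) (\<not> b)) c) = c" if "c \<in> gwords V" for c
    using that i by (induction c) (auto simp: cj_sg_cancel V_closed)
  show ?case
  proof (cases x)
    case (Sig i)
    then show ?thesis using c[OF cancel(2)] cancel by (auto intro: pres_cong.reflexive)
  next
    case (Tau i)
    have "([(t i, b), (t i, \<not> b)] @ a, [] @ a) \<in> VC"
    proof (rule pres_cong.compat)
      show "([(t i, b), (t i, \<not> b)], []) \<in> VC"
        using Tau cancel(1) by (intro pres_cong.cancel V.t) auto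
      show "(a, a) \<in> VC" by (rule pres_cong.reflexive[OF cancel(2)])
    qed
    moreover have "act [(x, b), (x, \<not> b)] a = [(t i, b), (t i, \<not> b)] @ a"
      using c[OF cancel(2)] i by (simp add: Tau cj_sg_same del: map_map)
    ultimately show ?thesis by simp
  qed
next
  case (reflexive u)
  then show ?case by (intro pres_cong.reflexive act_gwords)
next
  case (symmetric u v)
  show ?case by (rule pres_cong.symmetric[OF symmetric.IH[OF symmetric.prems]])
next
  case (transitive u v w)
  show ?case by (rule pres_cong.transitive[OF transitive.IH(1,2)[OF transitive.prems]])
next
  case (compat u u' v v')
  have gw: "u \<in> gwords S" "v' \<in> gwords S" using compat pres_cong_gwords by blast+
  have "(act u (act v a), act u (act v' a)) \<in> VC"
    by (rule act_VC[OF gw(1) compat.IH(2)[OF compat.prems]])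
  moreover have "(act u (act v' a), act u' (act v' a)) \<in> VC"
    by (rule compat.IH(1)[OF act_gwords[OF gw(2) compat.prems]])
  ultimately show ?case unfolding act_simps by (rule pres_cong.transitive)
qed

end

section \<open>The center of the singular braid group\<close>

context sing_braid begin

text \<open>Undoing conjugations brings some t_i into a non-empty \<open>T\<close>, and with it all
  its conjugates by powers of a neighbouring sigma_j. These are pairwise distinct because their
  Burau actions differ.\<close>

lemma invariant_subset_empty:
  assumes fin: "finite T" and TV: "T \<subseteq> V" and inv: "\<And>i b. i \<in> I \<Longrightarrow> cj (sg i b) ` T = T"
  shows "T = {}"
proof (rule ccontr)
  have "x \<in> T \<longrightarrow> (\<exists>i\<in>I. t i \<in> T)" if "x \<in> V" for x
    using that
  proof (induction rule: V.induct)
    case (cj x i b)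
    have "cj (sg i (\<not> b)) (cj (sg i b) x) = x"
      using cj_sg_cancel[OF cj(2) V_closed[OF cj(1)], of "\<not> b"] by simp
    then have "cj (sg i b) x \<in> T \<Longrightarrow> x \<in> T" using inv[OF cj(2), of "\<not> b"] by (metis imageI)
    then show ?case using cj by blast
  qed auto
  moreover assume "T \<noteq> {}"
  ultimately obtain i where i: "i \<in> I" "t i \<in> T" using TV by blast
  \<comment> \<open>A neighbour of i inside the range.\<close>
  define j where "j = (if i = 1 then 2 else i - 1)"
  have j: "j \<in> I" "1 \<le> i" "j = Suc i \<or> i = Suc j" using i n by (auto simp: j_def)
  define F where "F k = cj (s j [^]\<^bsub>G\<^esub> k) (t i)" for k :: nat
  have pc: "s j [^]\<^bsub>G\<^esub> k \<in> carrier G" for k :: nat using j(1) by simp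
  have FT: "F k \<in> T" for k
  proof (induction k)
    case 0
    then show ?case using i by (simp add: F_def)
  next
    case (Suc k)
    have "F (Suc k) = cj (sg j True) (F k)"
      unfolding F_def using G.nat_pow_Suc2[of "s j" k] j(1) i(1) by (simp add: G.conj_by_conj_by sg_simps)
    then show ?case using Suc inv[OF j(1), of True] by blast
  qed
  interpret burau: pres_hom bij_group S R burau by (rule pres_hom_burau)
  define \<rho> where "\<rho> = pres_lift bij_group burau"
  have hom: "\<rho> (x \<otimes>\<^bsub>G\<^esub> y) = \<rho> x \<circ> \<rho> y" if "x \<in> carrier G" "y \<in> carrier G" for x y
    using hom_mult[OF burau.pres_lift_hom, folded sing_braid_group_def, OF that] by (simp add: \<rho>_def)
  have \<rho>s: "\<rho> (s l) = transvection l" "\<rho> (tau l) = id" if "l \<in> I" for l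
    using burau.pres_lift_gen[of "Sig l"] burau.pres_lift_gen[of "Tau l"] that
    by (simp_all add: \<rho>_def s_def tau_def)
  have \<rho>pow: "\<rho> (s j [^]\<^bsub>G\<^esub> k) = transvection j ^^ k" for k :: nat
  proof (induction k)
    case 0
    have "\<rho> \<one>\<^bsub>G\<^esub> = word_eval bij_group burau []"
      unfolding \<rho>_def cls_Nil[symmetric] by (rule burau.pres_lift_class) simp
    then show ?case by (simp add: word_eval_def id_def)
  next
    case (Suc k)
    then show ?case using G.nat_pow_Suc2[of "s j" k] j(1) by (simp add: hom \<rho>s)
  qed
  \<comment> \<open>y is the preimage of the basis vector \<open>e\<close> under sigma_i, and
    sigma_j fixes \<open>e\<close>. Hence \<open>F k\<close> maps \<open>e\<close> to the image of y
    under sigma_j^k, whose coordinate j grows by 1 with k; the sign in y depends on the side of i on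
    which j lies.\<close>
  define y :: "nat \<Rightarrow> int" where "y = (\<lambda>_. 0)(j := 1, i := (if j = Suc i then 1 else -1))"
  define e :: "nat \<Rightarrow> int" where "e = (\<lambda>_. 0)(j := 1)"
  have ye: "transvection i y = e" and je: "(transvection j ^^ k) e = e" for k
    using j i by (auto simp: y_def e_def transvection_def transvection_power fun_eq_iff)
  have "\<rho> (F k) e j = 1 + int k" for k
  proof -
    \<comment> \<open>The definition of \<open>F k\<close> is multiplied out so that no inverse has
      to be evaluated.\<close>
    have "F k \<otimes>\<^bsub>G\<^esub> (s j [^]\<^bsub>G\<^esub> k \<otimes>\<^bsub>G\<^esub> s i) = s j [^]\<^bsub>G\<^esub> k \<otimes>\<^bsub>G\<^esub> tau i"
      unfolding F_def tau_eq[OF i(1)] using i(1) pc by (intro G.conj_by_swap_assoc) auto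
    then have "\<rho> (F k) \<circ> (\<rho> (s j [^]\<^bsub>G\<^esub> k) \<circ> \<rho> (s i)) = \<rho> (s j [^]\<^bsub>G\<^esub> k) \<circ> \<rho> (tau i)"
      using i(1) pc FT[of k] TV V_closed by (subst hom[symmetric] | simp add: hom[symmetric] subsetD)+
    then have "\<rho> (F k) ((transvection j ^^ k) (transvection i y)) = (transvection j ^^ k) y"
      unfolding \<rho>s[OF i(1)] \<rho>pow by (metis comp_apply id_apply)
    then have "\<rho> (F k) e j = (transvection j ^^ k) y j" by (simp add: ye je)
    also have "\<dots> = 1 + int k" using j by (auto simp: transvection_power y_def)
    finally show ?thesis .
  qed
  then have "inj F" by (metis add_left_cancel injI of_nat_eq_iff)
  then have "infinite (range F)" using finite_imageD infinite_UNIV_nat by blast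
  then show False using fin FT by (meson finite_subset image_subsetI)
qed

section \<open>Evaluation of words in the vertices\<close>

lemma id_V: "(\<lambda>x. x) \<in> V \<rightarrow> carrier G"
  using V_closed by auto

lemma pres_hom_id: "pres_hom G V RV (\<lambda>x. x)"
proof
  show "word_eval G (\<lambda>x. x) u = word_eval G (\<lambda>x. x) v" if "(u, v) \<in> RV" for u v
    using that V_closed by (auto simp: RV_def word_eval_def)
qed (rule id_V)

abbreviation "we \<equiv> word_eval G (\<lambda>x. x)"

lemma we_Cons: "we ((x, b) # a) = (if b then x else inv\<^bsub>G\<^esub> x) \<otimes>\<^bsub>G\<^esub> we a"
  by (simp add: word_eval_def)

lemma we_closed [simp]: "a \<in> gwords V \<Longrightarrow> we a \<in> carrier G"
  by (rule word_eval_closed[OF G.is_group id_V])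

lemma we_cjw: "a \<in> gwords V \<Longrightarrow> g \<in> carrier G \<Longrightarrow> we (cjw g a) = cj g (we a)"
proof (induction a)
  case Nil
  then show ?case by (simp add: word_eval_def)
next
  case (Cons p a)
  obtain x b where p: "p = (x, b)" by fastforce
  then show ?case using Cons V_closed[of x]
    by (simp add: we_Cons G.conj_by_mult G.conj_by_inv)
qed

text \<open>An element is its translation part, evaluated in the group, times its underlying braid.
  A trivial translation part therefore leaves just the braid.\<close>

lemma we_act: "w \<in> gwords S \<Longrightarrow> we (act w []) \<otimes>\<^bsub>G\<^esub> cls (desing w) = cls w"
proof (induction w)
  case Nil
  then show ?case by (simp add: word_eval_def cls_Nil)
next
  case (Cons p w)
  obtain x b where p: "p = (x, b)" by fastforce
  define i where "i = sgen_index x"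
  have i: "i \<in> I" and w: "w \<in> gwords S" and x: "x \<in> S" using Cons.prems p by (auto simp: i_def)
  have a: "act w [] \<in> gwords V" using act_gwords[OF w] by simp
  let ?a = "we (act w [])" and ?d = "cls (desing w)" and ?g = "sg i b" and ?p = "we (sing_part x b)"
  have cl: "?a \<in> carrier G" "?d \<in> carrier G" "?g \<in> carrier G" "?p \<in> carrier G"
    using a desing_gwords[OF w] i sing_part_gwords[OF x] by auto
  have d: "cls (desing (p # w)) = ?g \<otimes>\<^bsub>G\<^esub> ?d"
    using cls_append[of "[(Sig i, b)]" "desing w"] i desing_gwords[OF w] by (simp add: p sg_def i_def)
  have "we (act (p # w) []) = ?p \<otimes>\<^bsub>G\<^esub> cj ?g ?a"
    using word_eval_append[OF G.is_group id_V sing_part_gwords[OF x] cjw_gwords[OF a i]] cl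
    by (simp add: p we_cjw[OF a] flip: i_def)
  then have "we (act (p # w) []) \<otimes>\<^bsub>G\<^esub> cls (desing (p # w)) = ?p \<otimes>\<^bsub>G\<^esub> ?g \<otimes>\<^bsub>G\<^esub> (?a \<otimes>\<^bsub>G\<^esub> ?d)"
    unfolding d using cl by (simp add: G.m_assoc G.conj_by_swap_assoc)
  also have "?p \<otimes>\<^bsub>G\<^esub> ?g = cls [p]"
  proof (cases x)
    case (Sig l)
    then show ?thesis using cl by (simp add: word_eval_def p sg_def i_def)
  next
    case (Tau l)
    then have l: "l = i" by (simp add: i_def)
    show ?thesis
    proof (cases b)
      case True
      then show ?thesis using i tau_eq[OF i]
        by (simp add: Tau l p word_eval_def sg_simps tau_def)
    next
      case False
      have "inv\<^bsub>G\<^esub> t i \<otimes>\<^bsub>G\<^esub> inv\<^bsub>G\<^esub> s i = inv\<^bsub>G\<^esub> (s i \<otimes>\<^bsub>G\<^esub> t i)"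
        using i by (simp add: G.inv_mult_group)
      also have "s i \<otimes>\<^bsub>G\<^esub> t i = tau i"
        using G.conj_by_fix_commute[OF _ _ cj_s_same[OF i]] i tau_eq[OF i] by simp
      also have "inv\<^bsub>G\<^esub> tau i = cls [p]"
        using False i by (simp add: p Tau l cls_inv tau_def)
      finally show ?thesis using i False by (simp add: Tau l word_eval_def sg_simps)
    qed
  qed
  also have "cls [p] \<otimes>\<^bsub>G\<^esub> (?a \<otimes>\<^bsub>G\<^esub> ?d) = cls (p # w)"
    unfolding Cons.IH[OF w] using cls_append[of "[p]" w] x w p by simp
  finally show ?case .
qed

theorem center_desing:
  assumes w: "w \<in> gwords S" and z: "cls w \<in> group_center G"
  shows "cls (desing w) = cls w"
proof -
  interpret id: pres_hom G V RV "\<lambda>x. x" by (rule pres_hom_id)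
  let ?a = "act w []"
  have a: "?a \<in> gwords V" using act_gwords[OF w] by simp
  have fixed: "(?a, cjw (sg i b) ?a) \<in> VC" if i: "i \<in> I" for i b
  proof -
    let ?g = "[(Sig i, b)]"
    have g: "?g \<in> gwords S" using i by simp
    \<comment> \<open>sigma_i fixes the empty word. Letting both sides of this equation act on it
      shows that sigma_i also fixes the orbit point of w.\<close>
    have "cls (w @ ?g) = cls (?g @ w)"
      using centerD[OF z cls_closed[OF g]] cls_append[OF w g] cls_append[OF g w] by simp
    then have "(w @ ?g, ?g @ w) \<in> PC"
      using w g by (subst (asm) cls_eq_iff) auto
    from act_cong[OF this, of "[]"] show ?thesis by simp
  qed
  obtain T u where Tu: "finite T" "T \<subseteq> V" "u \<in> gwords T" "(?a, u) \<in> VC"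
    and inv: "\<And>f. f \<in> {cj (sg i b) | i b. i \<in> I} \<Longrightarrow> f ` T = T"
  proof (rule invariant_support[of RV "{cj (sg i b) | i b. i \<in> I}" V ?a])
    show "\<exists>x y. u = [x, y] \<and> v = [y, x]" if "(u, v) \<in> RV" for u v
      using that by (auto simp: RV_def)
    show "f x \<in> V" if "f \<in> {cj (sg i b) | i b. i \<in> I}" "x \<in> V" for f x
      using that by (auto intro: V.cj)
    show "(map (apfst f) u, map (apfst f) v) \<in> RV"
      if "f \<in> {cj (sg i b) | i b. i \<in> I}" "(u, v) \<in> RV" for f u v
      using that cjw_RV by blast
    show "(?a, map (apfst f) ?a) \<in> VC" if "f \<in> {cj (sg i b) | i b. i \<in> I}" for f
      using that fixed by blast
  qed (use a in blast)+
  have "T = {}" by (rule invariant_subset_empty[OF Tu(1,2)]) (use inv in blast)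
  then have "u = []" using Tu(3) by (cases u) auto
  then have "we ?a = we []" using id.word_eval_cong[OF Tu(4)] by simp
  then have "we ?a = \<one>\<^bsub>G\<^esub>" by (simp add: word_eval_def)
  then show ?thesis using we_act[OF w] desing_gwords[OF w] by simp
qed

theorem center_eq: "group_center G = {twist [^]\<^bsub>G\<^esub> k | k :: int. True}"
proof (intro equalityI subsetI)
  fix z assume z: "z \<in> group_center G"
  then obtain w where w: "w \<in> gwords S" "z = cls w" by (auto simp: group_center_def G_carrier)
  then show "z \<in> {twist [^]\<^bsub>G\<^esub> k | k :: int. True}"
    using desing_center[OF w(1)] center_desing[OF w(1)] z by auto
next
  fix z assume "z \<in> {twist [^]\<^bsub>G\<^esub> k | k :: int. True}"
  then obtain k :: int where k: "z = twist [^]\<^bsub>G\<^esub> k" by auto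
  have "z \<otimes>\<^bsub>G\<^esub> g = g \<otimes>\<^bsub>G\<^esub> z" if g: "g \<in> carrier G" for g
  proof -
    have nat: "twist [^]\<^bsub>G\<^esub> l \<otimes>\<^bsub>G\<^esub> g = g \<otimes>\<^bsub>G\<^esub> twist [^]\<^bsub>G\<^esub> l" for l :: nat
      using centerD[OF twist_central g] g by (intro G.group_commutes_pow) auto
    have inv: "inv\<^bsub>G\<^esub> x \<otimes>\<^bsub>G\<^esub> g = g \<otimes>\<^bsub>G\<^esub> inv\<^bsub>G\<^esub> x"
      if x: "x \<in> carrier G" "x \<otimes>\<^bsub>G\<^esub> g = g \<otimes>\<^bsub>G\<^esub> x" for x
    proof -
      have "G.conj_by g (inv\<^bsub>G\<^esub> x) = inv\<^bsub>G\<^esub> x"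
        using G.conj_by_eqI[of g x x] G.conj_by_inv[of g x] x g by simp
      then show ?thesis using G.conj_by_fix_commute[of g "inv\<^bsub>G\<^esub> x"] x g by simp
    qed
    show ?thesis unfolding k
      by (cases k rule: int_cases2) (simp_all add: int_pow_int G.int_pow_neg_int nat inv)
  qed
  then show "z \<in> group_center G" using k by (simp add: group_center_def)
qed

end

section \<open>The linking number of two strands\<close>

text \<open>\<open>\<sigma>\<^sub>i\<close> and \<open>\<tau>\<^sub>i\<close> move the two strands at positions \<open>a\<close> and \<open>b\<close>. Only the crossings
  in which the first strand starts on the left are counted, so that a full twist of the two
  strands counts as \<open>1\<close>.\<close>

definition crossing :: "nat \<Rightarrow> nat \<times> nat \<times> int \<Rightarrow> nat \<times> nat \<times> int" where
  "crossing i = (\<lambda>(a, b, c). (transpose i (Suc i) a, transpose i (Suc i) b,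
     c + (if a = i \<and> b = Suc i then 1 else 0)))"

definition uncrossing :: "nat \<Rightarrow> nat \<times> nat \<times> int \<Rightarrow> nat \<times> nat \<times> int" where
  "uncrossing i = (\<lambda>(a, b, c). (transpose i (Suc i) a, transpose i (Suc i) b,
     c - (if a = Suc i \<and> b = i then 1 else 0)))"

lemma crossing_apply:
  "crossing i (a, b, c) = (transpose i (Suc i) a, transpose i (Suc i) b, c + of_bool (a = i \<and> b = Suc i))"
  "uncrossing i (a, b, c) = (transpose i (Suc i) a, transpose i (Suc i) b, c - of_bool (a = Suc i \<and> b = i))"
  by (simp_all add: crossing_def uncrossing_def)

lemma crossing_inverse: "crossing i \<circ> uncrossing i = id" "uncrossing i \<circ> crossing i = id"
  by (auto simp: crossing_def uncrossing_def fun_eq_iff transpose_def)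

lemma bij_crossing: "bij (crossing i)"
  by (rule o_bij[OF crossing_inverse(2,1)])

lemma crossing_braid:
  "crossing i \<circ> (crossing (Suc i) \<circ> crossing i) = crossing (Suc i) \<circ> (crossing i \<circ> crossing (Suc i))"
proof
  fix p :: "nat \<times> nat \<times> int"
  obtain a b c where p: "p = (a, b, c)" by (cases p)
  show "(crossing i \<circ> (crossing (Suc i) \<circ> crossing i)) p = (crossing (Suc i) \<circ> (crossing i \<circ> crossing (Suc i))) p"
    unfolding p
    by (cases "a = i"; cases "a = Suc i"; cases "a = Suc (Suc i)"; cases "b = i"; cases "b = Suc i";
        cases "b = Suc (Suc i)") (simp_all add: crossing_apply transpose_def)
qed

lemma crossing_far:
  "\<bar>int i - int j\<bar> \<ge> 2 \<Longrightarrow> crossing i \<circ> crossing j = crossing j \<circ> crossing i"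
proof
  fix p :: "nat \<times> nat \<times> int"
  obtain a b c where p: "p = (a, b, c)" by (cases p)
  assume "\<bar>int i - int j\<bar> \<ge> 2"
  then have ij: "i \<noteq> j" "i \<noteq> Suc j" "j \<noteq> Suc i" by auto
  then have fix_ij: "transpose j (Suc j) x = i \<longleftrightarrow> x = i" "transpose j (Suc j) x = Suc i \<longleftrightarrow> x = Suc i"
    "transpose i (Suc i) x = j \<longleftrightarrow> x = j" "transpose i (Suc i) x = Suc j \<longleftrightarrow> x = Suc j" for x
    by (auto simp: transpose_def)
  have comm: "transpose i (Suc i) (transpose j (Suc j) x) = transpose j (Suc j) (transpose i (Suc i) x)" for x
    using ij by (simp add: transpose_def)
  show "(crossing i \<circ> crossing j) p = (crossing j \<circ> crossing i) p"
    unfolding p by (simp add: crossing_apply fix_ij comm[of a] comm[of b])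
qed

lemma pres_hom_crossing:
  "pres_hom bij_group (sing_braid_gens n) (sing_braid_rels n) (\<lambda>x. crossing (sgen_index x))"
proof -
  interpret group bij_group by (rule group_bij_group)
  show ?thesis
  proof
    show "(\<lambda>x. crossing (sgen_index x)) \<in> sing_braid_gens n \<rightarrow> carrier bij_group"
      by (auto simp: bij_crossing)
    show "word_eval bij_group (\<lambda>x. crossing (sgen_index x)) u = word_eval bij_group (\<lambda>x. crossing (sgen_index x)) v"
      if "(u, v) \<in> sing_braid_rels n" for u v
      using that unfolding sing_braid_rels_def
      by (elim imageE UnE) (auto simp: word_eval_bij_pos crossing_braid crossing_far)
  qed
qed

definition crossings :: "nat list \<Rightarrow> nat \<times> nat \<times> int \<Rightarrow> nat \<times> nat \<times> int" where
  "crossings w = foldr (\<lambda>i. (\<circ>) (crossing i)) w id"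

lemma crossings_simps [simp]: "crossings [] = id" "crossings (i # w) = crossing i \<circ> crossings w"
  by (simp_all add: crossings_def)

lemma crossings_append [simp]: "crossings (u @ v) = crossings u \<circ> crossings v"
  by (induction u) auto

text \<open>The rightmost letter acts first: the strand at position 1 travels to position k + 1
  across all the others, which move one place to the left. A crossing counts only if the travelling
  strand is the first of the pair.\<close>

lemma crossings_desc:
  assumes "a \<ge> 1" "b \<ge> 1"
  shows "crossings (desc_word k) (a, b, c) =
    (if a = 1 then Suc k else if a \<le> Suc k then a - 1 else a,
     if b = 1 then Suc k else if b \<le> Suc k then b - 1 else b,
     c + of_bool (a = 1 \<and> 1 < b \<and> b \<le> Suc k))"
proof (induction k)
  case 0
  then show ?case using assms by auto
next
  case (Suc k)
  have pos: "transpose (Suc k) (Suc (Suc k)) (if x = 1 then Suc k else if x \<le> Suc k then x - 1 else x)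
    = (if x = 1 then Suc (Suc k) else if x \<le> Suc (Suc k) then x - 1 else x)" if "x \<ge> 1" for x
    using that by (auto simp: transpose_def)
  have "crossings (desc_word (Suc k)) (a, b, c) = crossing (Suc k) (crossings (desc_word k) (a, b, c))"
    by simp
  also have "\<dots> = (if a = 1 then Suc (Suc k) else if a \<le> Suc (Suc k) then a - 1 else a,
     if b = 1 then Suc (Suc k) else if b \<le> Suc (Suc k) then b - 1 else b,
     c + of_bool (a = 1 \<and> 1 < b \<and> b \<le> Suc (Suc k)))"
    unfolding Suc crossing_apply pos[OF assms(1)] pos[OF assms(2)] prod.inject
    using assms by (cases "a = 1"; cases "b \<le> Suc k"; cases "b = Suc (Suc k)") (auto split: if_splits)
  finally show ?case .
qed

text \<open>A half twist reverses the positions and lets each pair cross once, so the pair counts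
  exactly if its first strand starts on the left.\<close>

lemma crossings_half_twist:
  "a \<ge> 1 \<Longrightarrow> b \<ge> 1 \<Longrightarrow> crossings (half_twist_word k) (a, b, c) =
    (if a \<le> Suc k then Suc (Suc k) - a else a, if b \<le> Suc k then Suc (Suc k) - b else b,
     c + of_bool (a < b \<and> b \<le> Suc k))"
proof (induction k arbitrary: a b c)
  case 0
  then show ?case by auto
next
  case (Suc k)
  let ?q = "\<lambda>x. if x = 1 then Suc (Suc k) else if x \<le> Suc (Suc k) then x - 1 else x"
  have q: "?q a \<ge> 1" "?q b \<ge> 1" using Suc.prems by auto
  have "crossings (half_twist_word (Suc k)) (a, b, c)
      = crossings (half_twist_word k) (?q a, ?q b, c + of_bool (a = 1 \<and> 1 < b \<and> b \<le> Suc (Suc k)))"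
    by (simp only: half_twist_word.simps crossings_append comp_apply crossings_desc[OF Suc.prems])
  also have "\<dots> = (if a \<le> Suc (Suc k) then Suc (Suc (Suc k)) - a else a,
      if b \<le> Suc (Suc k) then Suc (Suc (Suc k)) - b else b, c + of_bool (a < b \<and> b \<le> Suc (Suc k)))"
    unfolding Suc.IH[OF q] prod.inject
    using Suc.prems by (cases "a = 1"; cases "b = 1"; cases "a \<le> Suc (Suc k)"; cases "b \<le> Suc (Suc k)") (simp_all, linarith+)
  finally show ?case .
qed

text \<open>After the first half twist the first strand is on the right, so the second one
  contributes nothing.\<close>

lemma crossings_full_twist:
  "1 \<le> a \<Longrightarrow> a < b \<Longrightarrow> b \<le> Suc k \<Longrightarrow> crossings (full_twist_word k) (a, b, c) = (a, b, c + 1)"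
  by (auto simp: full_twist_word_def crossings_half_twist)

lemma even_length_full_twist: "even (length (full_twist_word k))"
  by (simp add: full_twist_word_def)

context sing_braid begin

abbreviation "SP \<equiv> sing_pure_braid_group n"
abbreviation "perm \<equiv> sing_braid_perm n"
abbreviation "K \<equiv> kernel G (sym_group n) perm"

definition link :: "sgen gword set \<Rightarrow> nat \<times> nat \<times> int \<Rightarrow> nat \<times> nat \<times> int" where
  "link = pres_lift bij_group (\<lambda>x. crossing (sgen_index x))"

definition linking :: "sgen gword set \<Rightarrow> int" where
  "linking g = snd (snd (link g (1, 2, 0)))"

lemma link_cls: "w \<in> gwords S \<Longrightarrow> link (cls w) = word_eval bij_group (\<lambda>x. crossing (sgen_index x)) w"
  unfolding link_def by (rule pres_hom.pres_lift_class[OF pres_hom_crossing])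

lemma link_mult: "x \<in> carrier G \<Longrightarrow> y \<in> carrier G \<Longrightarrow> link (x \<otimes>\<^bsub>G\<^esub> y) = link x \<circ> link y"
  using hom_mult[OF pres_hom.pres_lift_hom[OF pres_hom_crossing], folded sing_braid_group_def]
  by (simp add: link_def)

lemma perm_cls: "w \<in> gwords S \<Longrightarrow> perm (cls w) = word_eval (sym_group n) sgen_perm w"
  unfolding sing_braid_perm_def by (rule pres_hom.pres_lift_class[OF pres_hom_sing_braid])

text \<open>The positions move by the permutation, and the increment of the counter depends on the
  positions but not on the counter. Hence the counter is additive on elements that return both
  strands to their places.\<close>

lemma link_perm:
  assumes "g \<in> carrier G"
  shows "\<exists>d. \<forall>c. link g (a, b, c) = (perm g a, perm g b, c + d)"
proof -
  obtain w where w: "w \<in> gwords S" "g = cls w" using assms G_carrier by auto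
  have "\<exists>d. \<forall>c. word_eval bij_group (\<lambda>x. crossing (sgen_index x)) w (a, b, c)
      = (word_eval (sym_group n) sgen_perm w a, word_eval (sym_group n) sgen_perm w b, c + d)"
    using w(1)
  proof (induction w)
    case Nil
    then show ?case by (simp add: word_eval_def sym_group_one)
  next
    case (Cons p w)
    obtain x e where p: "p = (x, e)" by fastforce
    define i where "i = sgen_index x"
    have i: "i \<in> {1..n-1}" using Cons.prems by (auto simp: p i_def)
    have f: "inv\<^bsub>bij_group\<^esub> (crossing i) = uncrossing i"
      using bij_crossing[of i] o_bij[OF crossing_inverse[of i]] crossing_inverse[of i]
      by (intro group.inv_equality[OF group_bij_group]) auto
    have sp: "sgen_perm x = transpose i (Suc i)" by (cases x) (simp_all add: i_def)
    have tp: "transpose i (Suc i) permutes {1..n}" using i by (intro permutes_swap_id) auto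
    have g: "inv\<^bsub>sym_group n\<^esub> (transpose i (Suc i)) = transpose i (Suc i)"
      by (rule group.inv_equality[OF sym_group_is_group])
        (use tp in \<open>simp_all add: sym_group_carrier sym_group_mult sym_group_one\<close>)
    obtain d where d: "\<And>c. word_eval bij_group (\<lambda>x. crossing (sgen_index x)) w (a, b, c)
      = (word_eval (sym_group n) sgen_perm w a, word_eval (sym_group n) sgen_perm w b, c + d)"
      using Cons.IH Cons.prems by (auto simp: p)
    have e: "word_eval bij_group (\<lambda>x. crossing (sgen_index x)) (p # w)
      = (if e then crossing i else uncrossing i) \<circ> word_eval bij_group (\<lambda>x. crossing (sgen_index x)) w"
      "word_eval (sym_group n) sgen_perm (p # w) = transpose i (Suc i) \<circ> word_eval (sym_group n) sgen_perm w"
      by (simp_all add: word_eval_def p f g sp sym_group_mult flip: i_def)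
    let ?a = "word_eval (sym_group n) sgen_perm w a" and ?b = "word_eval (sym_group n) sgen_perm w b"
    show ?case unfolding e
      by (rule exI[of _ "d + (if e then of_bool (?a = i \<and> ?b = Suc i) else - of_bool (?a = Suc i \<and> ?b = i))"])
        (simp add: d crossing_apply)
  qed
  then show ?thesis using w link_cls perm_cls by simp
qed

lemma K_iff: "g \<in> K \<longleftrightarrow> g \<in> carrier G \<and> perm g = id"
  by (simp add: kernel_def sym_group_one)

lemma link_pure: "g \<in> K \<Longrightarrow> link g (1, 2, c) = (1, 2, c + linking g)"
  using link_perm[of g 1 2] unfolding K_iff linking_def by auto

sublocale perm: group_hom G "sym_group n" perm
  using group_sing_braid_group sym_group_is_group sing_braid_perm_hom
  by (simp add: group_hom_def group_hom_axioms_def)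

lemma subgroup_K: "subgroup K G"
  by (rule perm.subgroup_kernel)

lemma SP_simps [simp]: "carrier SP = K" "x \<otimes>\<^bsub>SP\<^esub> y = x \<otimes>\<^bsub>G\<^esub> y" "\<one>\<^bsub>SP\<^esub> = \<one>\<^bsub>G\<^esub>"
  by (simp_all add: sing_pure_braid_group_def)

lemma linking_mult:
  assumes "x \<in> K" "y \<in> K"
  shows "linking (x \<otimes>\<^bsub>G\<^esub> y) = linking x + linking y"
proof -
  have "link (x \<otimes>\<^bsub>G\<^esub> y) (1, 2, 0) = (1, 2, linking y + linking x)"
    using assms link_pure[of x "linking y"] link_pure[of y 0] by (simp add: link_mult K_iff)
  then show ?thesis by (simp add: linking_def)
qed

sublocale SP: group SP
  by (rule group_sing_pure_braid_group)

sublocale linking: group_hom SP integer_group linking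
proof -
  interpret int: group integer_group by simp
  show "group_hom SP integer_group linking"
    by unfold_locales (auto intro!: homI simp: linking_mult)
qed

lemma link_twist: "1 \<le> a \<Longrightarrow> a < b \<Longrightarrow> b \<le> n \<Longrightarrow> link twist (a, b, c) = (a, b, c + 1)"
proof -
  have "link twist = crossings ft"
    unfolding twist_def by (subst link_cls) (auto simp: set_ft word_eval_bij_pos crossings_def foldr_map comp_def)
  then show "1 \<le> a \<Longrightarrow> a < b \<Longrightarrow> b \<le> n \<Longrightarrow> ?thesis" using n by (simp add: crossings_full_twist)
qed

lemma twist_pure: "twist \<in> K"
proof -
  have p: "perm twist permutes {1..n}"
    using perm.hom_closed[OF twist_closed] by (simp add: sym_group_carrier)
  have pair: "perm twist a = a \<and> perm twist b = b" if "1 \<le> a" "a < b" "b \<le> n" for a b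
    using link_perm[OF twist_closed, of a b] link_twist[OF that] by auto
  \<comment> \<open>\<open>pair\<close> needs a second position to the right, so position n is
    obtained as the second member of a pair.\<close>
  have "perm twist a = a" if "1 \<le> a" "a \<le> n" for a
    using that n pair[of a n] pair[of "n - 1" n] by (cases "a < n") auto
  then have "perm twist a = a" for a using p by (cases "a \<in> {1..n}") (auto simp: permutes_not_in)
  then show ?thesis by (simp add: K_iff fun_eq_iff)
qed

lemma linking_twist: "linking twist = 1"
  using link_twist[of 1 2 0] n by (simp add: linking_def)

lemma SP_pow: "g \<in> K \<Longrightarrow> g [^]\<^bsub>SP\<^esub> (k::int) = g [^]\<^bsub>G\<^esub> k"
  unfolding sing_pure_braid_group_def by (rule G.int_pow_consistent[OF subgroup_K, symmetric])

lemma twist_pow_pure: "twist [^]\<^bsub>G\<^esub> (k::int) \<in> K"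
  by (rule G.subgroup_int_pow_closed[OF subgroup_K twist_pure])

lemma linking_twist_pow: "linking (twist [^]\<^bsub>G\<^esub> (k::int)) = k"
  using linking.hom_int_pow[of twist k] twist_pure by (simp add: SP_pow linking_twist)

section \<open>Splitting off the center\<close>

abbreviation "Z \<equiv> group_center G"

lemma subgroup_Z: "subgroup Z G"
proof
  show "Z \<subseteq> carrier G" by (auto simp: group_center_def)
  show "\<one>\<^bsub>G\<^esub> \<in> Z" by (simp add: group_center_def)
  show "x \<otimes>\<^bsub>G\<^esub> y \<in> Z" if xy: "x \<in> Z" "y \<in> Z" for x y
  proof -
    obtain k l :: int where "x = twist [^]\<^bsub>G\<^esub> k" "y = twist [^]\<^bsub>G\<^esub> l"
      using xy unfolding center_eq by blast
    then have "x \<otimes>\<^bsub>G\<^esub> y = twist [^]\<^bsub>G\<^esub> (k + l)" by (simp add: G.int_pow_mult)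
    then show ?thesis unfolding center_eq by blast
  qed
  show "inv\<^bsub>G\<^esub> x \<in> Z" if x: "x \<in> Z" for x
  proof -
    obtain k :: int where "x = twist [^]\<^bsub>G\<^esub> k" using x unfolding center_eq by blast
    then have "inv\<^bsub>G\<^esub> x = twist [^]\<^bsub>G\<^esub> (- k)" by (simp add: G.int_pow_neg)
    then show ?thesis unfolding center_eq by blast
  qed
qed

lemma Z_pure: "Z \<subseteq> K"
  unfolding center_eq using twist_pow_pure by blast

theorem direct_factor_pure: "direct_factor Z SP"
proof -
  have ZSP: "subgroup Z SP"
    unfolding sing_pure_braid_group_def by (rule G.subgroup_incl[OF subgroup_Z subgroup_K Z_pure])
  have comm: "z \<otimes>\<^bsub>SP\<^esub> x = x \<otimes>\<^bsub>SP\<^esub> z" if "z \<in> Z" "x \<in> K" for z x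
    using that centerD by (simp add: K_iff)
  let ?H = "kernel SP integer_group linking"
  have "Z \<lhd> SP"
  proof (subst SP.normal_inv_iff, intro conjI ballI ZSP)
    fix x z assume x: "x \<in> carrier SP" and z: "z \<in> Z"
    have zK: "z \<in> carrier SP" using z Z_pure by auto
    have "x \<otimes>\<^bsub>SP\<^esub> z \<otimes>\<^bsub>SP\<^esub> inv\<^bsub>SP\<^esub> x = z \<otimes>\<^bsub>SP\<^esub> (x \<otimes>\<^bsub>SP\<^esub> inv\<^bsub>SP\<^esub> x)"
      using comm[OF z, of x] x zK SP.m_assoc[OF zK x SP.inv_closed[OF x]] by simp
    also have "\<dots> = z" using x zK SP.r_inv[OF x] SP.r_one[OF zK] by simp
    finally show "x \<otimes>\<^bsub>SP\<^esub> z \<otimes>\<^bsub>SP\<^esub> inv\<^bsub>SP\<^esub> x \<in> Z" using z by simp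
  qed
  moreover have "?H \<lhd> SP" by (rule linking.normal_kernel)
  moreover have "Z \<inter> ?H = {\<one>\<^bsub>SP\<^esub>}"
  proof (intro equalityI subsetI)
    fix x assume x: "x \<in> Z \<inter> ?H"
    then obtain k :: int where k: "x = twist [^]\<^bsub>G\<^esub> k" unfolding center_eq by blast
    with x have "k = 0" using linking_twist_pow[of k] by (auto simp: kernel_def)
    then show "x \<in> {\<one>\<^bsub>SP\<^esub>}" using k by simp
  next
    fix x assume "x \<in> {\<one>\<^bsub>SP\<^esub>}"
    moreover have "\<one>\<^bsub>SP\<^esub> \<in> ?H" by (rule subgroup.one_closed[OF linking.subgroup_kernel])
    ultimately show "x \<in> Z \<inter> ?H" using subgroup.one_closed[OF ZSP] by auto
  qed
  moreover have "Z <#>\<^bsub>SP\<^esub> ?H = carrier SP"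
  proof (intro equalityI subsetI)
    fix x assume "x \<in> Z <#>\<^bsub>SP\<^esub> ?H"
    then obtain z h where "x = z \<otimes>\<^bsub>SP\<^esub> h" "z \<in> Z" "h \<in> ?H" by (auto simp: set_mult_def)
    moreover have "z \<in> carrier SP" "h \<in> carrier SP"
      using calculation Z_pure by (auto simp: kernel_def)
    ultimately show "x \<in> carrier SP" using SP.m_closed[of z h] by simp
  next
    fix x assume x: "x \<in> carrier SP"
    define k where "k = linking x"
    have tk: "twist [^]\<^bsub>G\<^esub> k \<in> carrier SP" "twist [^]\<^bsub>G\<^esub> (- k) \<in> carrier SP"
      using twist_pow_pure by auto
    have xG: "x \<in> carrier G" using x by (simp add: K_iff)
    \<comment> \<open>The full twist has linking number 1, so the power with exponent
      \<open>k\<close> removes exactly the linking number of x.\<close>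
    have "linking (twist [^]\<^bsub>G\<^esub> (- k) \<otimes>\<^bsub>SP\<^esub> x) = 0"
      using linking_mult[of "twist [^]\<^bsub>G\<^esub> (- k)" x] tk x linking_twist_pow[of "- k"] by (simp add: k_def)
    then have h: "twist [^]\<^bsub>G\<^esub> (- k) \<otimes>\<^bsub>SP\<^esub> x \<in> ?H"
      using SP.m_closed[OF tk(2) x] by (simp add: kernel_def)
    have "twist [^]\<^bsub>G\<^esub> k \<otimes>\<^bsub>G\<^esub> (twist [^]\<^bsub>G\<^esub> (- k) \<otimes>\<^bsub>G\<^esub> x)
        = (twist [^]\<^bsub>G\<^esub> k \<otimes>\<^bsub>G\<^esub> twist [^]\<^bsub>G\<^esub> (- k)) \<otimes>\<^bsub>G\<^esub> x"
      using xG by (simp add: G.m_assoc)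
    also have "twist [^]\<^bsub>G\<^esub> k \<otimes>\<^bsub>G\<^esub> twist [^]\<^bsub>G\<^esub> (- k) = \<one>\<^bsub>G\<^esub>"
      using G.int_pow_mult[OF twist_closed, of k "- k"] by simp
    finally have "x = twist [^]\<^bsub>G\<^esub> k \<otimes>\<^bsub>SP\<^esub> (twist [^]\<^bsub>G\<^esub> (- k) \<otimes>\<^bsub>SP\<^esub> x)"
      using xG by simp
    moreover have "twist [^]\<^bsub>G\<^esub> k \<in> Z" unfolding center_eq by blast
    ultimately show "x \<in> Z <#>\<^bsub>SP\<^esub> ?H" using h unfolding set_mult_def by blast
  qed
  ultimately show ?thesis
    using ZSP linking.subgroup_kernel unfolding direct_factor_def internal_direct_product_def by blast
qed

theorem not_direct_factor: "\<not> direct_factor Z G"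
proof
  assume "direct_factor Z G"
  then obtain H where H: "subgroup H G" and ZH: "Z \<inter> H = {\<one>\<^bsub>G\<^esub>}" "Z <#>\<^bsub>G\<^esub> H = carrier G"
    by (auto simp: direct_factor_def internal_direct_product_def)
  interpret H: subgroup H G by (rule H)
  have tZ: "twist [^]\<^bsub>G\<^esub> k \<in> Z" for k :: int unfolding center_eq by blast
  \<comment> \<open>The graph of the projection onto the center along \<open>H\<close>, with the
    center read as the integers.\<close>
  define Q where "Q g k \<longleftrightarrow> (\<exists>h\<in>H. g = twist [^]\<^bsub>G\<^esub> k \<otimes>\<^bsub>G\<^esub> h)" for g and k :: int
  have ex: "\<exists>k. Q g k" if "g \<in> carrier G" for g
  proof -
    have "g \<in> Z <#>\<^bsub>G\<^esub> H" using that ZH(2) by simp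
    then obtain z h where "z \<in> Z" "h \<in> H" "g = z \<otimes>\<^bsub>G\<^esub> h"
      by (auto simp: set_mult_def)
    moreover obtain k :: int where "z = twist [^]\<^bsub>G\<^esub> k" using \<open>z \<in> Z\<close> unfolding center_eq by blast
    ultimately show ?thesis unfolding Q_def by blast
  qed
  have mult: "Q (g \<otimes>\<^bsub>G\<^esub> g') (k + k')" if gk: "Q g k" "Q g' k'" for g g' k k'
  proof -
    obtain h h' where h: "h \<in> H" "h' \<in> H" "g = twist [^]\<^bsub>G\<^esub> k \<otimes>\<^bsub>G\<^esub> h" "g' = twist [^]\<^bsub>G\<^esub> k' \<otimes>\<^bsub>G\<^esub> h'"
      using gk by (auto simp: Q_def)
    have hG: "h \<in> carrier G" "h' \<in> carrier G" using h by auto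
    have "g \<otimes>\<^bsub>G\<^esub> g' = twist [^]\<^bsub>G\<^esub> k \<otimes>\<^bsub>G\<^esub> (h \<otimes>\<^bsub>G\<^esub> twist [^]\<^bsub>G\<^esub> k') \<otimes>\<^bsub>G\<^esub> h'"
      unfolding h using hG by (simp add: G.m_assoc)
    also have "h \<otimes>\<^bsub>G\<^esub> twist [^]\<^bsub>G\<^esub> k' = twist [^]\<^bsub>G\<^esub> k' \<otimes>\<^bsub>G\<^esub> h"
      using centerD[OF tZ hG(1)] by simp
    also have "twist [^]\<^bsub>G\<^esub> k \<otimes>\<^bsub>G\<^esub> (twist [^]\<^bsub>G\<^esub> k' \<otimes>\<^bsub>G\<^esub> h) \<otimes>\<^bsub>G\<^esub> h' = twist [^]\<^bsub>G\<^esub> (k + k') \<otimes>\<^bsub>G\<^esub> (h \<otimes>\<^bsub>G\<^esub> h')"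
      using hG by (simp add: G.int_pow_mult G.m_assoc)
    finally show ?thesis unfolding Q_def using h by blast
  qed
  have unique: "k = k'" if gk: "Q g k" "Q g k'" for g k k'
  proof -
    obtain h h' where h: "h \<in> H" "h' \<in> H" "g = twist [^]\<^bsub>G\<^esub> k \<otimes>\<^bsub>G\<^esub> h" "g = twist [^]\<^bsub>G\<^esub> k' \<otimes>\<^bsub>G\<^esub> h'"
      using gk by (auto simp: Q_def)
    have hG: "h \<in> carrier G" "h' \<in> carrier G" using h by auto
    have "twist [^]\<^bsub>G\<^esub> (k - k') = h' \<otimes>\<^bsub>G\<^esub> inv\<^bsub>G\<^esub> h"
    proof -
      have "twist [^]\<^bsub>G\<^esub> (k - k') \<otimes>\<^bsub>G\<^esub> h = twist [^]\<^bsub>G\<^esub> (- k') \<otimes>\<^bsub>G\<^esub> (twist [^]\<^bsub>G\<^esub> k \<otimes>\<^bsub>G\<^esub> h)"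
        using hG G.int_pow_mult[OF twist_closed, of "- k'" k] by (simp add: G.m_assoc)
      also have "\<dots> = twist [^]\<^bsub>G\<^esub> (- k') \<otimes>\<^bsub>G\<^esub> (twist [^]\<^bsub>G\<^esub> k' \<otimes>\<^bsub>G\<^esub> h')" using h by simp
      also have "\<dots> = h'"
        using hG G.int_pow_mult[OF twist_closed, of "- k'" k'] by (simp flip: G.m_assoc)
      finally have e: "twist [^]\<^bsub>G\<^esub> (k - k') \<otimes>\<^bsub>G\<^esub> h = h'" .
      show ?thesis using hG by (simp add: e[symmetric] G.m_assoc)
    qed
    then have "twist [^]\<^bsub>G\<^esub> (k - k') \<in> Z \<inter> H" using h tZ[of "k - k'"] by auto
    then have "twist [^]\<^bsub>G\<^esub> (k - k') = twist [^]\<^bsub>G\<^esub> (0::int)" using ZH(1) by simp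
    \<comment> \<open>Linking numbers show that the full twist has infinite order.\<close>
    then have "linking (twist [^]\<^bsub>G\<^esub> (k - k')) = linking (twist [^]\<^bsub>G\<^esub> (0::int))" by simp
    then show ?thesis by (simp only: linking_twist_pow)
  qed
  have same: "Q (s (Suc i)) k" if i: "1 \<le> i" "Suc i \<le> n - 1" "Q (s i) k" for i k
  proof -
    have iI: "i \<in> I" "Suc i \<in> I" using i by auto
    obtain k' where k': "Q (s (Suc i)) k'" using ex[OF st_closed(1)[OF iI(2)]] by blast
    have e: "s i \<otimes>\<^bsub>G\<^esub> (s (Suc i) \<otimes>\<^bsub>G\<^esub> s i) = s (Suc i) \<otimes>\<^bsub>G\<^esub> (s i \<otimes>\<^bsub>G\<^esub> s (Suc i))"
      using rel_cls[of "[Sig i, Sig (Suc i), Sig i]" "[Sig (Suc i), Sig i, Sig (Suc i)]"] iI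
      by (simp add: sing_rels_def cls_pos_Cons s_def)
    have "Q (s i \<otimes>\<^bsub>G\<^esub> (s (Suc i) \<otimes>\<^bsub>G\<^esub> s i)) (k + (k' + k))"
      by (intro mult i(3) k')
    moreover have "Q (s i \<otimes>\<^bsub>G\<^esub> (s (Suc i) \<otimes>\<^bsub>G\<^esub> s i)) (k' + (k + k'))"
      unfolding e by (intro mult i(3) k')
    \<comment> \<open>The braid relation yields 2k + k' = k + 2k', so neighbouring generators have
      equal values.\<close>
    ultimately have "k + (k' + k) = k' + (k + k')" by (rule unique)
    then show ?thesis using k' by simp
  qed
  have "1 \<in> I" using n by simp
  then obtain \<kappa> where \<kappa>: "Q (s 1) \<kappa>" using ex[OF st_closed(1)] by blast
  have all: "Q (s (Suc i)) \<kappa>" if "Suc i \<le> n - 1" for i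
    using that
  proof (induction i)
    case (Suc i)
    then show ?case using same[of "Suc i" \<kappa>] by simp
  qed (use \<kappa> in simp)
  have word: "Q (cls (sw w)) (\<kappa> * int (length w))" if "set w \<subseteq> I" for w
    using that
  proof (induction w)
    case Nil
    have "cls (sw []) = twist [^]\<^bsub>G\<^esub> (0::int) \<otimes>\<^bsub>G\<^esub> \<one>\<^bsub>G\<^esub>" by (simp add: pos_word_def cls_Nil)
    then show ?case unfolding Q_def using H.one_closed by auto
  next
    case (Cons i w)
    have "set (map Sig w) \<subseteq> S" using Cons.prems by auto
    then have "cls (sw (i # w)) = s i \<otimes>\<^bsub>G\<^esub> cls (sw w)"
      using cls_pos_Cons[of "Sig i" "map Sig w"] Cons.prems by (simp add: s_def)
    moreover have "Q (s i) \<kappa>" using all[of "i - 1"] Cons.prems by auto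
    moreover have "Q (cls (sw w)) (\<kappa> * int (length w))" using Cons by auto
    ultimately have "Q (cls (sw (i # w))) (\<kappa> + \<kappa> * int (length w))" using mult by simp
    then show ?case by (simp add: algebra_simps)
  qed
  have "Q twist (\<kappa> * int (length ft))" unfolding twist_def by (rule word) (simp add: set_ft)
  moreover have "Q twist 1" unfolding Q_def by (rule bexI[of _ "\<one>\<^bsub>G\<^esub>"]) auto
  ultimately have one: "\<kappa> * int (length ft) = 1" using unique by blast
  have "even (\<kappa> * int (length ft))" using even_length_full_twist[of "n - 1"] by simp
  then show False unfolding one by simp
qed

end

theorem theorem5p3:
  fixes n :: nat
  assumes "n \<ge> 3"
  shows "direct_factor (group_center (sing_braid_group n)) (sing_pure_braid_group n)
       \<and> \<not> direct_factor (group_center (sing_braid_group n)) (sing_braid_group n)"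
proof -
  interpret sing_braid n by unfold_locales (rule assms)
  show ?thesis using direct_factor_pure not_direct_factor by blast
qed

end
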